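(* Let $u_h:[0,T]\to V_h$ be a solution of the semi-discrete scheme: for all $t\in[0,T]$, $$(\ddot u_h(t),\tilde u)+a^\epsilon(u_h(t),\tilde u)=(b(t),\tilde u)\qquad\forall\,\tilde u\in V_h .$$ Then the semi-discrete scheme is stable, and the energy $\mathcal E^\epsilon(u_h)(t)$ satisfies, for $t\in[0,T]$, $$\mathcal E^\epsilon(u_h)(t)\le\left[\sqrt{\mathcal E^\epsilon(u_h)(0)}+\int_0^t\|b(\tau)\|\,d\tau\right]^2 .$$
   Context: Let $d\in\{2,3\}$ and let $D\subset\mathbb R^d$ (the material domain) be an open set with $C^1$ boundary. $\epsilon>0$ is the horizon, $H_\epsilon(x)=\{y\in\mathbb R^d:|y-x|<\epsilon\}$, and $\omega_d$ is the volume of the unit ball in $\mathbb R^d$. The density is $\rho=1$. $(\cdot,\cdot)$ and $\|\cdot\|$ are the $L^2(D;\mathbb R^d)$ inner product and norm. The body force $b:[0,T]\to L^2(D;\mathbb R^d)$ is continuous in time. $V_h\subset H^1_0(D;\mathbb R^d)$ is the space of continuous piecewise linear functions on a conforming, shape regular mesh $\mathcal T_h$ of triangles/tetrahedra of size $h$; functions are extended by zero outside $D$. Influence function: $J^\epsilon(r)=J(r/\epsilon)$, $0\le J(r)\le M$ for $r<1$, $J(r)=0$ for $r\ge1$. Boundary function: $\omega:D\to[0,1]$ equals $1$ in the interior and decays smoothly to $0$ at $\partial D$, with bounded first and second derivatives; it is extended by zero outside $D$. Strains: with $e_{y-x}=\frac{y-x}{|y-x|}$, $$S(y,x;u)=\frac{u(y)-u(x)}{|y-x|}\cdot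 e_{y-x},\qquad \theta(x;u)=\frac1{\epsilon^d\omega_d}\int_{H_\epsilon(x)}\omega(y)J^\epsilon(|y-x|)S(y,x;u)|y-x|\,dy.$$ Potentials: $f$ is four times differentiable with $f$ and its derivatives up to order $4$ bounded, nonnegative, with a well at the origin ($f(0)=f'(0)=0$), convex between its inflection points $r^-<0<r^+$ and concave outside. $g$ is either quadratic with one well at zero ($g(r)=\beta r^2/2$, $\beta>0$) or of the same convex-concave type, with the same regularity, as $f$. Nonlinear form: $a^\epsilon=a^\epsilon_T+a^\epsilon_D$, where $$a^\epsilon_T(u,v)=\frac1{\epsilon^{d+1}\omega_d}\int_D\int_D\omega(x)\omega(y)J^\epsilon(|y-x|)\sqrt{|y-x|}\,f'\big(\sqrt{|y-x|}S(y,x;u)\big)S(y,x;v)\,dy\,dx,$$ $$a^\epsilon_D(u,v)=\frac1{\epsilon^2}\int_D\omega(x)g'(\theta(x;u))\theta(x;v)\,dx.$$ Energy: $\mathcal E^\epsilon(u)(t)=\frac12\|\dot u(t)\|^2+PD^\epsilon(u(t))$ with $$PD^\epsilon(u)=\frac1{\epsilon^d\omega_d}\int_D\int_{H_\epsilon(x)}|y-x|\,\omega(x)\omega(y)\frac{J^\epsilon(|y-x|)}{\epsilon|y-x|}f\big(\sqrt{|y-x|}S(y,x;u)\big)\,dy\,dx+\int_D\omega(x)\frac{g(\theta(x;u))}{\epsilon^2}\,dx.$$ *)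

theory Defs
  imports "HOL-Analysis.Analysis"
begin

section \<open>Domain, mesh and finite element space\<close>

text \<open>Near each boundary point \<open>D\<close> is the strict epigraph of a \<open>C\<^sup>1\<close> function over the
  hyperplane orthogonal to some unit vector \<open>n\<close>. The graph function is evaluated only on that
  hyperplane; taking it on the whole space loses nothing.\<close>

definition C1_boundary :: "(real^'d) set \<Rightarrow> bool" where
  "C1_boundary D \<longleftrightarrow>
     (\<forall>p\<in>frontier D. \<exists>r>0. \<exists>n :: real^'d. \<exists>\<gamma> :: real^'d \<Rightarrow> real. \<exists>\<gamma>' :: real^'d \<Rightarrow> ((real^'d) \<Rightarrow>\<^sub>L real).
        norm n = 1 \<and>
        (\<forall>z. (\<gamma> has_derivative blinfun_apply (\<gamma>' z)) (at z)) \<and> continuous_on UNIV \<gamma>' \<and>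
        D \<inter> ball p r = {x \<in> ball p r. x \<bullet> n > \<gamma> (x - (x \<bullet> n) *\<^sub>R n)})"

definition inradius :: "(real^'d) set \<Rightarrow> real" where
  "inradius K = Sup {r. 0 \<le> r \<and> (\<exists>x. cball x r \<subseteq> K)}"

text \<open>Conformity is the face condition contained in \<^const>\<open>triangulation\<close>. The closed elements lie
  in the closure of \<open>D\<close>, but are not required to cover it: a finite union of straight simplices
  never equals the closure of a \<open>C\<^sup>1\<close> domain.\<close>

definition shape_regular_mesh :: "(real^'d) set \<Rightarrow> real \<Rightarrow> real \<Rightarrow> (real^'d) set set \<Rightarrow> bool" where
  "shape_regular_mesh D \<sigma> h \<T> \<longleftrightarrow>
     triangulation \<T> \<and> \<T> \<noteq> {} \<and>
     (\<forall>K\<in>\<T>. int CARD('d) simplex K \<and> K \<subseteq> closure D) \<and>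
     h = Max (diameter ` \<T>) \<and>
     (\<forall>K\<in>\<T>. diameter K \<le> \<sigma> * inradius K)"

text \<open>The functions are already extended by zero to the whole space; being continuous there,
  piecewise affine and zero outside \<open>D\<close> makes them elements of \<open>H\<^sub>0\<^sup>1(D)\<close>.\<close>

definition P1_space :: "(real^'d) set \<Rightarrow> (real^'d) set set \<Rightarrow> (real^'d \<Rightarrow> real^'d) set" where
  "P1_space D \<T> =
     {u. continuous_on UNIV u \<and>
         (\<forall>K\<in>\<T>. \<exists>A c. linear A \<and> (\<forall>x\<in>K. u x = A x + c)) \<and>
         (\<forall>x. x \<notin> D \<inter> \<Union>\<T> \<longrightarrow> u x = 0)}"

section \<open>The space \<open>L\<^sup>2(D)\<close> and functions of time with values in it\<close>

text \<open>Elements are represented by functions on the whole space whose values off \<open>D\<close> are ignored.\<close>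

definition L2_on :: "(real^'d) set \<Rightarrow> (real^'d \<Rightarrow> real^'d) set" where
  "L2_on D = {u. u \<in> borel_measurable (lebesgue_on D) \<and>
                 integrable (lebesgue_on D) (\<lambda>x. (norm (u x))\<^sup>2)}"

definition L2_inner :: "(real^'d) set \<Rightarrow> (real^'d \<Rightarrow> real^'d) \<Rightarrow> (real^'d \<Rightarrow> real^'d) \<Rightarrow> real" where
  "L2_inner D u v = (LINT x|lebesgue_on D. u x \<bullet> v x)"

definition L2_norm :: "(real^'d) set \<Rightarrow> (real^'d \<Rightarrow> real^'d) \<Rightarrow> real" where
  "L2_norm D u = sqrt (L2_inner D u u)"

definition L2_continuous_on ::
    "(real^'d) set \<Rightarrow> real set \<Rightarrow> (real \<Rightarrow> real^'d \<Rightarrow> real^'d) \<Rightarrow> bool" where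
  "L2_continuous_on D I b \<longleftrightarrow>
     (\<forall>t\<in>I. b t \<in> L2_on D) \<and>
     (\<forall>t\<in>I. ((\<lambda>s. L2_norm D (\<lambda>x. b s x - b t x)) \<longlongrightarrow> 0) (at t within I))"

definition has_L2_time_derivative ::
    "(real^'d) set \<Rightarrow> real set \<Rightarrow> (real \<Rightarrow> real^'d \<Rightarrow> real^'d) \<Rightarrow> (real \<Rightarrow> real^'d \<Rightarrow> real^'d) \<Rightarrow> bool" where
  "has_L2_time_derivative D I u u' \<longleftrightarrow>
     (\<forall>t\<in>I. ((\<lambda>s. L2_norm D (\<lambda>x. (u s x - u t x) /\<^sub>R (s - t) - u' t x)) \<longlongrightarrow> 0) (at t within I))"

section \<open>Material functions\<close>

definition influence_function :: "real \<Rightarrow> (real \<Rightarrow> real) \<Rightarrow> bool" where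
  "influence_function M J \<longleftrightarrow>
     J \<in> borel_measurable (restrict_space borel {0..}) \<and>
     (\<forall>r. 0 \<le> r \<and> r < 1 \<longrightarrow> 0 \<le> J r \<and> J r \<le> M) \<and> (\<forall>r\<ge>1. J r = 0)"

text \<open>The layer in which \<open>\<omega>\<close> may differ from 1 has thickness \<open>\<delta>\<close>.\<close>

definition boundary_function :: "(real^'d) set \<Rightarrow> real \<Rightarrow> (real^'d \<Rightarrow> real) \<Rightarrow> bool" where
  "boundary_function D \<delta> \<omega> \<longleftrightarrow>
     (\<forall>x. 0 \<le> \<omega> x \<and> \<omega> x \<le> 1) \<and>
     (\<forall>x. x \<notin> D \<longrightarrow> \<omega> x = 0) \<and>
     (\<forall>x\<in>D. (\<forall>y\<in>frontier D. \<delta> \<le> dist x y) \<longrightarrow> \<omega> x = 1) \<and>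
     (\<forall>p\<in>frontier D. (\<omega> \<longlongrightarrow> 0) (at p within D)) \<and>
     (\<exists>\<omega>' :: real^'d \<Rightarrow> ((real^'d) \<Rightarrow>\<^sub>L real). \<exists>\<omega>'' :: real^'d \<Rightarrow> ((real^'d) \<Rightarrow>\<^sub>L ((real^'d) \<Rightarrow>\<^sub>L real)).
        (\<forall>x\<in>D. (\<omega> has_derivative blinfun_apply (\<omega>' x)) (at x)) \<and>
        (\<forall>x\<in>D. (\<omega>' has_derivative blinfun_apply (\<omega>'' x)) (at x)) \<and>
        continuous_on D \<omega>'' \<and> bounded (\<omega>' ` D) \<and> bounded (\<omega>'' ` D))"

definition convex_concave_potential :: "(real \<Rightarrow> real) \<Rightarrow> real \<Rightarrow> real \<Rightarrow> bool" where
  "convex_concave_potential f rm rp \<longleftrightarrow>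
     (\<forall>k<4. \<forall>r. ((deriv ^^ k) f) field_differentiable (at r)) \<and>
     (\<forall>k\<le>4. bounded (range ((deriv ^^ k) f))) \<and>
     (\<forall>r. 0 \<le> f r) \<and> f 0 = 0 \<and> deriv f 0 = 0 \<and>
     rm < 0 \<and> 0 < rp \<and>
     convex_on {rm..rp} f \<and> concave_on {..rm} f \<and> concave_on {rp..} f"

section \<open>Strains, nonlinear form and energy\<close>

definition strain :: "real^'d \<Rightarrow> real^'d \<Rightarrow> (real^'d \<Rightarrow> real^'d) \<Rightarrow> real" where
  "strain y x u = ((u y - u x) /\<^sub>R norm (y - x)) \<bullet> ((y - x) /\<^sub>R norm (y - x))"

definition dilation ::
    "real \<Rightarrow> (real \<Rightarrow> real) \<Rightarrow> (real^'d \<Rightarrow> real) \<Rightarrow> real^'d \<Rightarrow> (real^'d \<Rightarrow> real^'d) \<Rightarrow> real" where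
  "dilation \<epsilon> J \<omega> x u =
     1 / (\<epsilon> ^ CARD('d) * unit_ball_vol (real CARD('d))) *
     (LINT y|lebesgue_on (ball x \<epsilon>). \<omega> y * J (norm (y - x) / \<epsilon>) * strain y x u * norm (y - x))"

definition form_T ::
    "real \<Rightarrow> (real^'d) set \<Rightarrow> (real \<Rightarrow> real) \<Rightarrow> (real^'d \<Rightarrow> real) \<Rightarrow> (real \<Rightarrow> real) \<Rightarrow>
     (real^'d \<Rightarrow> real^'d) \<Rightarrow> (real^'d \<Rightarrow> real^'d) \<Rightarrow> real" where
  "form_T \<epsilon> D J \<omega> f u v =
     1 / (\<epsilon> ^ (CARD('d) + 1) * unit_ball_vol (real CARD('d))) *
     (LINT x|lebesgue_on D. LINT y|lebesgue_on D.
        \<omega> x * \<omega> y * J (norm (y - x) / \<epsilon>) * sqrt (norm (y - x)) *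
        deriv f (sqrt (norm (y - x)) * strain y x u) * strain y x v)"

definition form_D ::
    "real \<Rightarrow> (real^'d) set \<Rightarrow> (real \<Rightarrow> real) \<Rightarrow> (real^'d \<Rightarrow> real) \<Rightarrow> (real \<Rightarrow> real) \<Rightarrow>
     (real^'d \<Rightarrow> real^'d) \<Rightarrow> (real^'d \<Rightarrow> real^'d) \<Rightarrow> real" where
  "form_D \<epsilon> D J \<omega> g u v =
     1 / \<epsilon>\<^sup>2 * (LINT x|lebesgue_on D. \<omega> x * deriv g (dilation \<epsilon> J \<omega> x u) * dilation \<epsilon> J \<omega> x v)"

definition nonlocal_form ::
    "real \<Rightarrow> (real^'d) set \<Rightarrow> (real \<Rightarrow> real) \<Rightarrow> (real^'d \<Rightarrow> real) \<Rightarrow> (real \<Rightarrow> real) \<Rightarrow> (real \<Rightarrow> real) \<Rightarrow>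
     (real^'d \<Rightarrow> real^'d) \<Rightarrow> (real^'d \<Rightarrow> real^'d) \<Rightarrow> real" where
  "nonlocal_form \<epsilon> D J \<omega> f g u v = form_T \<epsilon> D J \<omega> f u v + form_D \<epsilon> D J \<omega> g u v"

definition potential_energy ::
    "real \<Rightarrow> (real^'d) set \<Rightarrow> (real \<Rightarrow> real) \<Rightarrow> (real^'d \<Rightarrow> real) \<Rightarrow> (real \<Rightarrow> real) \<Rightarrow> (real \<Rightarrow> real) \<Rightarrow>
     (real^'d \<Rightarrow> real^'d) \<Rightarrow> real" where
  "potential_energy \<epsilon> D J \<omega> f g u =
     1 / (\<epsilon> ^ CARD('d) * unit_ball_vol (real CARD('d))) *
     (LINT x|lebesgue_on D. LINT y|lebesgue_on (ball x \<epsilon>).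
        norm (y - x) * \<omega> x * \<omega> y * (J (norm (y - x) / \<epsilon>) / (\<epsilon> * norm (y - x))) *
        f (sqrt (norm (y - x)) * strain y x u)) +
     (LINT x|lebesgue_on D. \<omega> x * (g (dilation \<epsilon> J \<omega> x u) / \<epsilon>\<^sup>2))"

definition total_energy ::
    "real \<Rightarrow> (real^'d) set \<Rightarrow> (real \<Rightarrow> real) \<Rightarrow> (real^'d \<Rightarrow> real) \<Rightarrow> (real \<Rightarrow> real) \<Rightarrow> (real \<Rightarrow> real) \<Rightarrow>
     (real^'d \<Rightarrow> real^'d) \<Rightarrow> (real^'d \<Rightarrow> real^'d) \<Rightarrow> real" where
  "total_energy \<epsilon> D J \<omega> f g u v = 1 / 2 * (L2_norm D v)\<^sup>2 + potential_energy \<epsilon> D J \<omega> f g u"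

text \<open>The functions \<open>v\<close> and \<open>a\<close> are the first and second time derivatives of \<open>u\<close>. On the
  finite-dimensional space \<open>V\<close> differentiability in \<open>L\<^sup>2(D)\<close> is differentiability in every norm;
  requiring \<open>v t\<close> and \<open>a t\<close> to lie in \<open>V\<close> selects their continuous representatives.\<close>

definition semidiscrete_solution ::
    "real \<Rightarrow> (real^'d) set \<Rightarrow> (real \<Rightarrow> real) \<Rightarrow> (real^'d \<Rightarrow> real) \<Rightarrow> (real \<Rightarrow> real) \<Rightarrow> (real \<Rightarrow> real) \<Rightarrow>
     real \<Rightarrow> (real \<Rightarrow> real^'d \<Rightarrow> real^'d) \<Rightarrow> (real^'d \<Rightarrow> real^'d) set \<Rightarrow>
     (real \<Rightarrow> real^'d \<Rightarrow> real^'d) \<Rightarrow> (real \<Rightarrow> real^'d \<Rightarrow> real^'d) \<Rightarrow> (real \<Rightarrow> real^'d \<Rightarrow> real^'d) \<Rightarrow> bool" where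
  "semidiscrete_solution \<epsilon> D J \<omega> f g T b V u v a \<longleftrightarrow>
     (\<forall>t\<in>{0..T}. u t \<in> V \<and> v t \<in> V \<and> a t \<in> V) \<and>
     has_L2_time_derivative D {0..T} u v \<and> has_L2_time_derivative D {0..T} v a \<and>
     (\<forall>t\<in>{0..T}. \<forall>w\<in>V. L2_inner D (a t) w + nonlocal_form \<epsilon> D J \<omega> f g (u t) w = L2_inner D (b t) w)"

end

theory Submission
  imports Defs
begin

text \<open>
  The nonlinear form \<open>a\<^sup>\<epsilon>(u, \<cdot>)\<close> is the derivative of the potential energy at \<open>u\<close>. Testing the scheme
  with the velocity therefore gives the energy identity \<open>dE/dt = (b, v)\<close>. The potential energy is
  nonnegative, so \<open>\<parallel>v\<parallel> \<le> 2 sqrt E\<close>, hence \<open>dE/dt \<le> 2 \<parallel>b\<parallel> sqrt E\<close>; that is, \<open>sqrt E\<close> grows at most at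
  rate \<open>\<parallel>b\<parallel>\<close>. Integrating in time is the claim. Since \<open>sqrt\<close> is not differentiable at 0, the last
  step is carried out for \<open>sqrt (E + \<eta>)\<close> and \<open>\<eta>\<close> is sent to 0 (\<open>sqrt_energy_bound\<close>).

  The work lies in the energy identity: the solution is differentiable in time only in the \<open>L\<^sup>2\<close>
  sense, whereas the energy involves pointwise difference quotients of the displacement. On
  the finite element space the Lipschitz constant of a function is bounded by a multiple of its
  \<open>L\<^sup>2\<close> norm (\<open>P1_space_uniformly_lipschitz\<close>), so convergence in \<open>L\<^sup>2\<close> becomes uniform convergence
  of displacement components, strains and dilations alike. Each part of the energy is an integral
  \<open>\<integral> W f(l(u))\<close>, where \<open>l\<close> is one of these linear quantities, \<open>W\<close> a bounded weight and \<open>f\<close> a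
  potential whose derivative is Lipschitz continuous. All mesh functions are supported in one ball
  and the horizon is finite, so only a set of finite measure contributes, and a single
  differentiation lemma (\<open>observed_potential_has_derivative\<close>) covers the kinetic energy, the
  pairwise energy and the dilatational energy.
\<close>

section \<open>Differentiating integrals of a potential\<close>

text \<open>This class contains the convex-concave potentials as well as the quadratic one, whose
  derivative is unbounded, so both admissible forms of \<open>g\<close> are treated by the same estimates.\<close>

definition lipschitz_potential :: "real \<Rightarrow> (real \<Rightarrow> real) \<Rightarrow> bool" where
  "lipschitz_potential K f \<longleftrightarrow>
     0 \<le> K \<and> (\<forall>r. 0 \<le> f r) \<and> f 0 = 0 \<and> deriv f 0 = 0 \<and>
     (\<forall>r. (f has_real_derivative deriv f r) (at r)) \<and>
     (\<forall>r s. \<bar>deriv f r - deriv f s\<bar> \<le> K * \<bar>r - s\<bar>)"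

lemma lipschitz_potential_deriv_bound:
  assumes "lipschitz_potential K f"
  shows "\<bar>deriv f r\<bar> \<le> K * \<bar>r\<bar>"
  using assms unfolding lipschitz_potential_def by (metis diff_zero)

text \<open>The mean value theorem produces the factor \<open>K\<close> rather than the optimal \<open>K / 2\<close>; only the
  quadratic order in \<open>s - r\<close> matters for differentiability.\<close>

lemma lipschitz_potential_taylor:
  assumes "lipschitz_potential K f"
  shows "\<bar>f s - f r - deriv f r * (s - r)\<bar> \<le> K * (s - r)\<^sup>2"
proof -
  have d: "(f has_real_derivative deriv f x) (at x)" for x
    using assms by (simp add: lipschitz_potential_def)
  have "\<exists>z. \<bar>z - r\<bar> \<le> \<bar>s - r\<bar> \<and> f s - f r = deriv f z * (s - r)"
  proof (cases r s rule: linorder_cases)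
    case less
    then obtain z where "r < z" "z < s" "f s - f r = (s - r) * deriv f z"
      using MVT2[of r s f "deriv f"] d by blast
    then show ?thesis by (intro exI[of _ z]) (auto simp: mult.commute)
  next
    case greater
    then obtain z where "s < z" "z < r" "f r - f s = (r - s) * deriv f z"
      using MVT2[of s r f "deriv f"] d by blast
    then show ?thesis by (intro exI[of _ z]) (auto simp: algebra_simps)
  qed auto
  then obtain z where z: "\<bar>z - r\<bar> \<le> \<bar>s - r\<bar>" "f s - f r = deriv f z * (s - r)"
    by blast
  have "\<bar>f s - f r - deriv f r * (s - r)\<bar> = \<bar>deriv f z - deriv f r\<bar> * \<bar>s - r\<bar>"
    unfolding z(2) by (simp add: abs_mult[symmetric] algebra_simps)
  also have "\<dots> \<le> (K * \<bar>z - r\<bar>) * \<bar>s - r\<bar>"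
    using assms by (intro mult_right_mono) (auto simp: lipschitz_potential_def)
  also have "\<dots> \<le> (K * \<bar>s - r\<bar>) * \<bar>s - r\<bar>"
    using assms z(1) by (intro mult_right_mono mult_left_mono) (auto simp: lipschitz_potential_def)
  finally show ?thesis by (simp add: power2_eq_square mult.assoc)
qed

lemma lipschitz_potential_bound:
  assumes "lipschitz_potential K f"
  shows "\<bar>f r\<bar> \<le> K * r\<^sup>2"
  using lipschitz_potential_taylor[OF assms, of r 0] assms by (simp add: lipschitz_potential_def)

lemma lipschitz_potential_measurable:
  assumes "lipschitz_potential K f"
  shows "f \<in> borel_measurable borel" "deriv f \<in> borel_measurable borel"
proof -
  have "continuous_on UNIV f"
    using assms by (auto simp: lipschitz_potential_def continuous_on_eq_continuous_at intro: DERIV_isCont)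
  then show "f \<in> borel_measurable borel" by (rule borel_measurable_continuous_onI)
  have "K-lipschitz_on UNIV (deriv f)"
    using assms by (intro lipschitz_onI) (auto simp: lipschitz_potential_def dist_real_def)
  then show "deriv f \<in> borel_measurable borel"
    by (intro borel_measurable_continuous_onI lipschitz_on_continuous_on)
qed

text \<open>The second derivative is bounded, so the first one is Lipschitz continuous.\<close>

lemma convex_concave_lipschitz_potential:
  assumes "convex_concave_potential f rm rp"
  shows "\<exists>K. lipschitz_potential K f"
proof -
  have dk: "\<And>k r. k < 4 \<Longrightarrow> ((deriv ^^ k) f) field_differentiable (at r)"
    and bk: "\<And>k. k \<le> 4 \<Longrightarrow> bounded (range ((deriv ^^ k) f))"
    using assms by (auto simp: convex_concave_potential_def)
  have d0: "(f has_real_derivative deriv f r) (at r)" for r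
    using dk[of 0 r] by (simp add: DERIV_deriv_iff_field_differentiable)
  have d1: "(deriv f has_real_derivative deriv (deriv f) r) (at r)" for r
    using dk[of 1 r] by (simp add: DERIV_deriv_iff_field_differentiable)
  obtain K where K: "\<And>r. \<bar>deriv (deriv f) r\<bar> \<le> K"
    using bk[of 2] by (auto simp: bounded_iff numeral_2_eq_2)
  have "\<bar>deriv f r - deriv f s\<bar> \<le> K * \<bar>r - s\<bar>" for r s
    using field_differentiable_bound[of UNIV "deriv f" "deriv (deriv f)" K r s] d1 K by auto
  moreover have "0 \<le> K" using K[of 0] by linarith
  ultimately show ?thesis
    using d0 assms by (auto simp: lipschitz_potential_def convex_concave_potential_def)
qed

lemma quadratic_lipschitz_potential:
  fixes g :: "real \<Rightarrow> real"
  assumes "0 \<le> \<beta>" "\<And>r. g r = \<beta> * r\<^sup>2 / 2"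
  shows "lipschitz_potential \<beta> g" and "deriv g r = \<beta> * r"
proof -
  have g: "g = (\<lambda>r. \<beta> * r\<^sup>2 / 2)" using assms by auto
  have d: "(g has_real_derivative \<beta> * r) (at r)" for r
    unfolding g by (auto intro!: derivative_eq_intros)
  show dg: "deriv g r = \<beta> * r" for r using d by (rule DERIV_imp_deriv)
  have "\<bar>\<beta> * r - \<beta> * s\<bar> = \<beta> * \<bar>r - s\<bar>" for r s
    using assms(1) by (simp add: right_diff_distrib[symmetric] abs_mult)
  then show "lipschitz_potential \<beta> g"
    using assms(1) d by (simp add: lipschitz_potential_def dg) (simp add: assms(2))
qed

lemma integrable_bounded_finite_support:
  fixes h :: "'p \<Rightarrow> real"
  assumes "h \<in> borel_measurable N" "A \<in> sets N" "emeasure N A < \<infinity>"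
    and "\<And>p. p \<in> A \<Longrightarrow> \<bar>h p\<bar> \<le> c" "\<And>p. p \<notin> A \<Longrightarrow> h p = 0"
  shows "integrable N h" and "\<bar>integral\<^sup>L N h\<bar> \<le> c * measure N A"
proof -
  have i: "integrable N (\<lambda>p. c * indicator A p)"
    using assms by (intro integrable_mult_right integrable_real_indicator) auto
  have b: "\<bar>h p\<bar> \<le> c * indicator A p" for p
    using assms(4,5) by (cases "p \<in> A") auto
  show h: "integrable N h"
    using i assms(1) by (rule Bochner_Integration.integrable_bound) (use b in \<open>auto intro: order_trans[OF _ abs_ge_self]\<close>)
  have "\<bar>integral\<^sup>L N h\<bar> \<le> (\<integral>p. c * indicator A p \<partial>N)"
    using order_trans[OF integral_norm_bound integral_mono[OF integrable_norm[OF h] i]] b by simp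
  also have "\<dots> = c * measure N A" using assms(2) by simp
  finally show "\<bar>integral\<^sup>L N h\<bar> \<le> c * measure N A" .
qed

lemma integrable_weighted_potential:
  assumes "lipschitz_potential K f" "0 \<le> M"
    and W: "W \<in> borel_measurable N" "\<And>p. 0 \<le> W p" "\<And>p. W p \<le> M"
    and A: "A \<in> sets N" "emeasure N A < \<infinity>"
    and phi: "\<phi> \<in> borel_measurable N" "\<And>p. p \<in> A \<Longrightarrow> \<bar>\<phi> p\<bar> \<le> B" "\<And>p. p \<notin> A \<Longrightarrow> W p = 0 \<or> \<phi> p = 0"
    and psi: "\<psi> \<in> borel_measurable N" "\<And>p. p \<in> A \<Longrightarrow> \<bar>\<psi> p\<bar> \<le> B'" "\<And>p. p \<notin> A \<Longrightarrow> W p = 0 \<or> \<psi> p = 0"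
  shows "integrable N (\<lambda>p. W p * f (\<phi> p))" "integrable N (\<lambda>p. W p * deriv f (\<phi> p) * \<psi> p)"
proof -
  note [measurable] = W(1) phi(1) psi(1) lipschitz_potential_measurable[OF assms(1)]
  have K: "0 \<le> K" "f 0 = 0" using assms(1) by (auto simp: lipschitz_potential_def)
  show "integrable N (\<lambda>p. W p * f (\<phi> p))"
  proof (rule integrable_bounded_finite_support(1)[OF _ A, of _ "M * (K * B\<^sup>2)"])
    fix p assume "p \<in> A"
    then have "(\<phi> p)\<^sup>2 \<le> B\<^sup>2" using phi(2)[of p] by (simp add: abs_le_square_iff[symmetric])
    then have "\<bar>f (\<phi> p)\<bar> \<le> K * B\<^sup>2"
      using lipschitz_potential_bound[OF assms(1), of "\<phi> p"] K by (meson mult_left_mono order_trans)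
    then show "\<bar>W p * f (\<phi> p)\<bar> \<le> M * (K * B\<^sup>2)"
      unfolding abs_mult using W(2,3)[of p] assms(2) by (intro mult_mono) auto
  qed (use phi(3) K in fastforce)+
  show "integrable N (\<lambda>p. W p * deriv f (\<phi> p) * \<psi> p)"
  proof (rule integrable_bounded_finite_support(1)[OF _ A, of _ "M * (K * B) * B'"])
    fix p assume p: "p \<in> A"
    have "\<bar>deriv f (\<phi> p)\<bar> \<le> K * B"
      using lipschitz_potential_deriv_bound[OF assms(1), of "\<phi> p"] K phi(2)[OF p]
      by (meson mult_left_mono order_trans)
    moreover from this have "0 \<le> K * B" by linarith
    ultimately show "\<bar>W p * deriv f (\<phi> p) * \<psi> p\<bar> \<le> M * (K * B) * B'"
      unfolding abs_mult using W(2,3)[of p] assms(2) psi(2)[OF p] by (intro mult_mono) auto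
  qed (use psi(3) in fastforce)+
qed

text \<open>The difference quotient of \<open>f \<circ> \<phi>\<close> differs from \<open>f'(\<phi>) \<psi>\<close> by at most
  \<open>\<bar>f'(\<phi>)\<bar> e + K (B' + e)\<^sup>2 \<bar>s - t\<bar>\<close>: the first term is the error of the difference quotient of \<open>\<phi>\<close>
  itself, the second the Taylor remainder of \<open>f\<close>. This bound is uniform on \<open>A\<close>, and off \<open>A\<close> the
  integrand vanishes, so the error of the integrals is at most the bound times \<open>M\<close> times the
  measure of \<open>A\<close>.\<close>

lemma weighted_potential_has_derivative:
  fixes \<phi> :: "real \<Rightarrow> 'p \<Rightarrow> real"
  assumes f: "lipschitz_potential K f" and M: "0 \<le> M"
    and W: "W \<in> borel_measurable N" "\<And>p. 0 \<le> W p" "\<And>p. W p \<le> M"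
    and A: "A \<in> sets N" "emeasure N A < \<infinity>" and t: "t \<in> I"
    and phi: "\<And>s. s \<in> I \<Longrightarrow> \<phi> s \<in> borel_measurable N" "\<And>s p. s \<in> I \<Longrightarrow> p \<in> A \<Longrightarrow> \<bar>\<phi> s p\<bar> \<le> B s"
      "\<And>s p. s \<in> I \<Longrightarrow> p \<notin> A \<Longrightarrow> W p = 0 \<or> \<phi> s p = 0"
    and psi: "\<psi> \<in> borel_measurable N" "\<And>p. p \<in> A \<Longrightarrow> \<bar>\<psi> p\<bar> \<le> B'" "\<And>p. p \<notin> A \<Longrightarrow> W p = 0 \<or> \<psi> p = 0"
    and e: "\<And>s p. s \<in> I \<Longrightarrow> s \<noteq> t \<Longrightarrow> p \<in> A \<Longrightarrow> \<bar>(\<phi> s p - \<phi> t p) / (s - t) - \<psi> p\<bar> \<le> e s"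
      "(e \<longlongrightarrow> 0) (at t within I)"
  shows "((\<lambda>s. \<integral>p. W p * f (\<phi> s p) \<partial>N) has_real_derivative (\<integral>p. W p * deriv f (\<phi> t p) * \<psi> p \<partial>N))
           (at t within I)"
proof -
  define q where "q s = ((\<integral>p. W p * f (\<phi> s p) \<partial>N) - (\<integral>p. W p * f (\<phi> t p) \<partial>N)) / (s - t)" for s
  define d where "d = (\<integral>p. W p * deriv f (\<phi> t p) * \<psi> p \<partial>N)"
  define c where "c s = K * B t * e s + K * (B' + e s)\<^sup>2 * \<bar>s - t\<bar>" for s
  have K: "0 \<le> K" "f 0 = 0" using f by (auto simp: lipschitz_potential_def)
  have int: "integrable N (\<lambda>p. W p * f (\<phi> s p))" "integrable N (\<lambda>p. W p * deriv f (\<phi> s p) * \<psi> p)"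
    if "s \<in> I" for s
    by (rule integrable_weighted_potential[OF f M W A phi(1)[OF that] phi(2)[OF that] phi(3)[OF that] psi];
        assumption)+
  note [measurable] = W(1) phi(1) phi(1)[OF t] psi(1) lipschitz_potential_measurable[OF f]
  have "\<bar>q s - d\<bar> \<le> M * c s * measure N A" if s: "s \<in> I" "s \<noteq> t" for s
  proof -
    define r where "r p = (f (\<phi> s p) - f (\<phi> t p)) / (s - t) - deriv f (\<phi> t p) * \<psi> p" for p
    have [measurable]: "r \<in> borel_measurable N"
      unfolding r_def using s(1) by measurable
    have "q s - d = (\<integral>p. (W p * f (\<phi> s p) - W p * f (\<phi> t p)) / (s - t) - W p * deriv f (\<phi> t p) * \<psi> p \<partial>N)"
      unfolding q_def d_def using int[OF s(1)] int[OF t] s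
      by simp
    also have "\<dots> = (\<integral>p. W p * r p \<partial>N)"
      by (rule Bochner_Integration.integral_cong) (auto simp: r_def algebra_simps diff_divide_distrib)
    finally have qd: "q s - d = (\<integral>p. W p * r p \<partial>N)" .
    have "\<bar>W p * r p\<bar> \<le> M * c s" if p: "p \<in> A" for p
    proof -
      define \<Delta> where "\<Delta> = (\<phi> s p - \<phi> t p) / (s - t)"
      have \<Delta>: "\<phi> s p - \<phi> t p = \<Delta> * (s - t)" using s by (simp add: \<Delta>_def)
      have e': "\<bar>\<Delta> - \<psi> p\<bar> \<le> e s" unfolding \<Delta>_def by (rule e(1)[OF s p])
      have "\<Delta>\<^sup>2 \<le> (B' + e s)\<^sup>2"
        using e' psi(2)[OF p] by (subst abs_le_square_iff[symmetric]) linarith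
      then have 1: "K * (\<Delta>\<^sup>2 * \<bar>s - t\<bar>) \<le> K * ((B' + e s)\<^sup>2 * \<bar>s - t\<bar>)"
        using K by (intro mult_left_mono mult_right_mono) auto
      have "(f (\<phi> s p) - f (\<phi> t p)) / (s - t) - deriv f (\<phi> t p) * \<Delta> =
          (f (\<phi> s p) - f (\<phi> t p) - deriv f (\<phi> t p) * (\<phi> s p - \<phi> t p)) / (s - t)"
        using s by (simp add: \<Delta>_def diff_divide_distrib right_diff_distrib)
      then have "\<bar>(f (\<phi> s p) - f (\<phi> t p)) / (s - t) - deriv f (\<phi> t p) * \<Delta>\<bar> =
          \<bar>f (\<phi> s p) - f (\<phi> t p) - deriv f (\<phi> t p) * (\<phi> s p - \<phi> t p)\<bar> / \<bar>s - t\<bar>"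
        by (simp only: abs_divide)
      also have "\<dots> \<le> K * (\<phi> s p - \<phi> t p)\<^sup>2 / \<bar>s - t\<bar>"
        by (intro divide_right_mono lipschitz_potential_taylor[OF f]) auto
      also have "\<dots> = K * (\<Delta>\<^sup>2 * (\<bar>s - t\<bar>\<^sup>2 / \<bar>s - t\<bar>))"
        unfolding \<Delta> by (simp add: power_mult_distrib)
      also have "\<bar>s - t\<bar>\<^sup>2 / \<bar>s - t\<bar> = \<bar>s - t\<bar>"
        using s unfolding power2_eq_square by (intro nonzero_mult_div_cancel_left) simp
      finally have 2: "\<bar>(f (\<phi> s p) - f (\<phi> t p)) / (s - t) - deriv f (\<phi> t p) * \<Delta>\<bar> \<le> K * (\<Delta>\<^sup>2 * \<bar>s - t\<bar>)" .
      have "\<bar>deriv f (\<phi> t p)\<bar> \<le> K * B t"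
        using lipschitz_potential_deriv_bound[OF f, of "\<phi> t p"] K phi(2)[OF t p]
        by (meson mult_left_mono order_trans)
      then have 3: "\<bar>deriv f (\<phi> t p) * (\<Delta> - \<psi> p)\<bar> \<le> K * B t * e s"
        unfolding abs_mult using e' by (intro mult_mono) auto
      have "r p = ((f (\<phi> s p) - f (\<phi> t p)) / (s - t) - deriv f (\<phi> t p) * \<Delta>) + deriv f (\<phi> t p) * (\<Delta> - \<psi> p)"
        by (simp add: r_def algebra_simps)
      then have "\<bar>r p\<bar> \<le> c s" unfolding c_def using 1 2 3 by (simp add: mult.assoc)
      then show ?thesis unfolding abs_mult using W(2,3)[of p] M by (intro mult_mono) auto
    qed
    moreover have "W p * r p = 0" if "p \<notin> A" for p
      using phi(3)[OF s(1) that] phi(3)[OF t that] psi(3)[OF that] by (auto simp: r_def)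
    ultimately show ?thesis unfolding qd
      by (intro integrable_bounded_finite_support(2)[OF _ A]) auto
  qed
  then have ev: "\<forall>\<^sub>F s in at t within I. norm (q s - d) \<le> M * c s * measure N A"
    by (auto simp: eventually_at_filter)
  have "((\<lambda>s. M * c s * measure N A) \<longlongrightarrow> M * (K * B t * 0 + K * (B' + 0)\<^sup>2 * \<bar>t - t\<bar>) * measure N A) (at t within I)"
    unfolding c_def by (intro tendsto_intros e(2))
  then have "((\<lambda>s. q s - d) \<longlongrightarrow> 0) (at t within I)"
    using ev by (intro Lim_null_comparison[OF ev]) simp
  then show ?thesis
    unfolding has_field_derivative_iff q_def d_def using LIM_zero_iff by blast
qed

section \<open>Integrals over Lebesgue measurable sets and Fubini\<close>

text \<open>Every integrand of interest is Borel measurable and vanishes off its domain of integration.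
  Passing to the Borel--Lebesgue measure on the whole space puts all domains on the same footing
  and makes product measurability and Fubini's theorem directly usable.\<close>

lemma lebesgue_on_integral_eq_lborel:
  fixes h :: "'a::euclidean_space \<Rightarrow> real"
  assumes "h \<in> borel_measurable borel" "S \<in> sets borel" "\<And>x. x \<notin> S \<Longrightarrow> h x = 0"
  shows "(LINT x|lebesgue_on S. h x) = (LINT x|lborel. h x)"
proof -
  have "(LINT x|lebesgue_on S. h x) = (LINT x|lebesgue. indicator S x *\<^sub>R h x)"
    using assms(2) by (intro integral_restrict_space) auto
  also have "(\<lambda>x. indicator S x *\<^sub>R h x) = h" using assms(3) by (force simp: indicator_def)
  also have "(LINT x|lebesgue. h x) = (LINT x|lborel. h x)"
    using assms(1) by (intro integral_completion) simp
  finally show ?thesis .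
qed

lemma iterated_lebesgue_on_integral_eq:
  fixes h :: "'a::euclidean_space \<times> 'b::euclidean_space \<Rightarrow> real"
  assumes h: "integrable (lborel \<Otimes>\<^sub>M lborel) h"
    and S: "S \<in> sets borel" "\<And>x. U x \<in> sets borel"
    and zero: "\<And>x y. x \<notin> S \<or> y \<notin> U x \<Longrightarrow> h (x, y) = 0"
  shows "(LINT x|lebesgue_on S. LINT y|lebesgue_on (U x). h (x, y)) = integral\<^sup>L (lborel \<Otimes>\<^sub>M lborel) h"
proof -
  have [measurable]: "h \<in> borel_measurable (lborel \<Otimes>\<^sub>M lborel)" using h by auto
  have [measurable]: "(\<lambda>y. h (x, y)) \<in> borel_measurable borel" for x
    by measurable
  have "(LINT y|lebesgue_on (U x). h (x, y)) = (LINT y|lborel. h (x, y))" for x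
    using S zero by (intro lebesgue_on_integral_eq_lborel) auto
  moreover have "(\<lambda>x. LINT y|lborel. h (x, y)) \<in> borel_measurable borel"
  proof -
    have "(\<lambda>x. LINT y|lborel. h (x, y)) \<in> borel_measurable lborel"
      by measurable
    then show ?thesis by simp
  qed
  ultimately have "(LINT x|lebesgue_on S. LINT y|lebesgue_on (U x). h (x, y)) = (LINT x|lborel. LINT y|lborel. h (x, y))"
    using S zero by (simp, intro lebesgue_on_integral_eq_lborel) auto
  also have "\<dots> = integral\<^sup>L (lborel \<Otimes>\<^sub>M lborel) h"
    using h by (rule lborel_pair.integral_fst')
  finally show ?thesis .
qed

section \<open>The Hilbert space structure of \<open>L\<^sup>2\<close>\<close>

lemma L2_inner_integrable:
  assumes "u \<in> L2_on D" "v \<in> L2_on D"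
  shows "integrable (lebesgue_on D) (\<lambda>x. u x \<bullet> v x)"
proof -
  have [measurable]: "u \<in> borel_measurable (lebesgue_on D)" "v \<in> borel_measurable (lebesgue_on D)"
    using assms by (auto simp: L2_on_def)
  have b: "\<bar>u x \<bullet> v x\<bar> \<le> (norm (u x))\<^sup>2 + (norm (v x))\<^sup>2" for x
  proof -
    have "\<bar>u x \<bullet> v x\<bar> \<le> norm (u x) * norm (v x)" by (rule Cauchy_Schwarz_ineq2)
    also have "\<dots> \<le> (norm (u x))\<^sup>2 + (norm (v x))\<^sup>2"
      using sum_squares_bound[of "norm (u x)" "norm (v x)"]
        mult_nonneg_nonneg[OF norm_ge_zero[of "u x"] norm_ge_zero[of "v x"]] by linarith
    finally show ?thesis .
  qed
  show ?thesis
    by (rule Bochner_Integration.integrable_bound[where f = "\<lambda>x. (norm (u x))\<^sup>2 + (norm (v x))\<^sup>2"])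
      (use assms b in \<open>auto simp: L2_on_def intro: order_trans[OF _ abs_ge_self]\<close>)
qed

lemma L2_norm_nonneg: "0 \<le> L2_norm D u"
  by (auto simp: L2_norm_def L2_inner_def intro!: Bochner_Integration.integral_nonneg)

lemma L2_norm_power2: "(L2_norm D u)\<^sup>2 = L2_inner D u u"
  unfolding L2_norm_def by (intro real_sqrt_pow2) (auto simp: L2_inner_def intro!: Bochner_Integration.integral_nonneg)

text \<open>As a function of \<open>c\<close> this is a nonnegative quadratic polynomial, which yields the
  Cauchy--Schwarz inequality; at \<open>c = 1\<close> it gives the triangle inequality.\<close>

lemma L2_norm_power2_add_scaled:
  assumes "u \<in> L2_on D" "v \<in> L2_on D"
  shows "(L2_norm D (\<lambda>x. u x + c *\<^sub>R v x))\<^sup>2 = (L2_norm D u)\<^sup>2 + 2 * c * L2_inner D u v + c\<^sup>2 * (L2_norm D v)\<^sup>2"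
proof -
  note i = L2_inner_integrable[OF assms(1) assms(1)] L2_inner_integrable[OF assms] L2_inner_integrable[OF assms(2) assms(2)]
  have "(u x + c *\<^sub>R v x) \<bullet> (u x + c *\<^sub>R v x) = u x \<bullet> u x + 2 * c * (u x \<bullet> v x) + c\<^sup>2 * (v x \<bullet> v x)" for x
    by (simp add: inner_add_left inner_add_right inner_commute power2_eq_square algebra_simps)
  then show ?thesis
    unfolding L2_norm_power2 L2_inner_def using i by simp
qed

lemma L2_Cauchy_Schwarz:
  assumes "u \<in> L2_on D" "v \<in> L2_on D"
  shows "\<bar>L2_inner D u v\<bar> \<le> L2_norm D u * L2_norm D v"
proof -
  define p q r where "p = (L2_norm D u)\<^sup>2" "q = L2_inner D u v" "r = (L2_norm D v)\<^sup>2"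
  have pos: "0 \<le> p + 2 * c * q + c\<^sup>2 * r" for c
    unfolding p_q_r_def L2_norm_power2_add_scaled[OF assms, symmetric] by (rule zero_le_power2)
  have "q\<^sup>2 \<le> p * r"
  proof (cases "r = 0")
    case True
    have "q = 0"
    proof (rule ccontr)
      assume "q \<noteq> 0"
      \<comment> \<open>The quadratic degenerates to \<open>p + 2 c q\<close>, which this \<open>c\<close> makes equal to \<open>-1\<close>.\<close>
      with pos[of "- (p + 1) / (2 * q)"] True show False by (simp add: field_simps)
    qed
    then show ?thesis using True by simp
  next
    case False
    then have r: "0 < r" by (simp add: p_q_r_def)
    have "0 \<le> r * (p + 2 * (- q / r) * q + (- q / r)\<^sup>2 * r)"
      using pos[of "- q / r"] r by (intro mult_nonneg_nonneg) auto
    also have "\<dots> = p * r - q\<^sup>2" using r by (simp add: field_simps power2_eq_square)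
    finally show ?thesis by simp
  qed
  then have "\<bar>q\<bar> \<le> sqrt (p * r)" using real_le_rsqrt by (simp add: real_le_rsqrt)
  then show ?thesis by (simp add: p_q_r_def real_sqrt_mult L2_norm_nonneg)
qed

lemma L2_norm_triangle:
  assumes "u \<in> L2_on D" "v \<in> L2_on D"
  shows "L2_norm D (\<lambda>x. u x + v x) \<le> L2_norm D u + L2_norm D v"
proof (rule power2_le_imp_le)
  show "(L2_norm D (\<lambda>x. u x + v x))\<^sup>2 \<le> (L2_norm D u + L2_norm D v)\<^sup>2"
    using L2_norm_power2_add_scaled[OF assms, of 1] L2_Cauchy_Schwarz[OF assms]
    by (simp add: power2_sum)
qed (simp add: L2_norm_nonneg)

lemma L2_on_diff:
  assumes "u \<in> L2_on D" "v \<in> L2_on D"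
  shows "(\<lambda>x. u x - v x) \<in> L2_on D"
proof -
  have "(norm (u x - v x))\<^sup>2 = u x \<bullet> u x - 2 * (u x \<bullet> v x) + v x \<bullet> v x" for x
    by (simp add: power2_norm_eq_inner inner_diff_left inner_diff_right inner_commute)
  moreover have "integrable (lebesgue_on D) (\<lambda>x. u x \<bullet> u x - 2 * (u x \<bullet> v x) + v x \<bullet> v x)"
    using assms by (intro Bochner_Integration.integrable_add Bochner_Integration.integrable_diff integrable_mult_right L2_inner_integrable)
  ultimately show ?thesis using assms by (auto simp: L2_on_def intro!: borel_measurable_diff)
qed

lemma L2_norm_minus_commute: "L2_norm D (\<lambda>x. u x - v x) = L2_norm D (\<lambda>x. v x - u x)"
  unfolding L2_norm_def L2_inner_def by (simp add: inner_diff_left inner_diff_right algebra_simps)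

lemma L2_continuous_on_norm:
  assumes "L2_continuous_on D I b"
  shows "continuous_on I (\<lambda>t. L2_norm D (b t))"
proof -
  have "((\<lambda>s. L2_norm D (b s)) \<longlongrightarrow> L2_norm D (b t)) (at t within I)" if t: "t \<in> I" for t
  proof -
    have "\<bar>L2_norm D (b s) - L2_norm D (b t)\<bar> \<le> L2_norm D (\<lambda>x. b s x - b t x)" if s: "s \<in> I" for s
    proof -
      have b: "b s \<in> L2_on D" "b t \<in> L2_on D" using assms s t by (auto simp: L2_continuous_on_def)
      show ?thesis
        using L2_norm_triangle[OF L2_on_diff[OF b(1,2)] b(2)] L2_norm_triangle[OF L2_on_diff[OF b(2,1)] b(1)]
          L2_norm_minus_commute[of D "b s" "b t"] by simp
    qed
    then have ev: "\<forall>\<^sub>F s in at t within I. norm (L2_norm D (b s) - L2_norm D (b t)) \<le> L2_norm D (\<lambda>x. b s x - b t x)"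
      by (auto simp: eventually_at_filter)
    then have "((\<lambda>s. L2_norm D (b s) - L2_norm D (b t)) \<longlongrightarrow> 0) (at t within I)"
      using assms t by (intro Lim_null_comparison[OF ev]) (auto simp: L2_continuous_on_def)
    then show ?thesis using LIM_zero_iff by blast
  qed
  then show ?thesis by (simp add: continuous_on_def)
qed

section \<open>From the differential inequality to the energy bound\<close>

text \<open>For \<open>\<eta> > 0\<close> the function \<open>sqrt (E + \<eta>) - \<integral> \<beta>\<close> is differentiable also where \<open>E\<close> vanishes, and
  its derivative \<open>E' / (2 sqrt (E + \<eta>)) - \<beta>\<close> is nonpositive. Letting \<open>\<eta>\<close> tend to 0 keeps the
  resulting inequality.\<close>

lemma sqrt_energy_bound:
  fixes E \<beta> :: "real \<Rightarrow> real"
  assumes E: "\<And>t. t \<in> {0..T} \<Longrightarrow> (E has_real_derivative E' t) (at t within {0..T})"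
    and pos: "\<And>t. t \<in> {0..T} \<Longrightarrow> 0 \<le> E t"
    and \<beta>: "continuous_on {0..T} \<beta>" "\<And>t. t \<in> {0..T} \<Longrightarrow> 0 \<le> \<beta> t"
    and le: "\<And>t. t \<in> {0..T} \<Longrightarrow> E' t \<le> 2 * \<beta> t * sqrt (E t)"
    and t: "t \<in> {0..T}"
  shows "E t \<le> (sqrt (E 0) + integral {0..t} \<beta>)\<^sup>2"
proof -
  define G where "G s = integral {0..s} \<beta>" for s
  have step: "sqrt (E t + \<eta>) \<le> sqrt (E 0 + \<eta>) + G t" if \<eta>: "0 < \<eta>" for \<eta>
  proof (cases "t = 0")
    case True then show ?thesis by (simp add: G_def)
  next
    case False
    then have t0: "0 < t" using t by simp
    have der: "((\<lambda>s. sqrt (E s + \<eta>) - G s) has_real_derivative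
        E' s * (inverse (sqrt (E s + \<eta>)) / 2) - \<beta> s) (at s within {0..t})"
      if s: "0 \<le> s" "s \<le> t" for s
    proof -
      have sT: "s \<in> {0..T}" using s t by auto
      have "((\<lambda>s. sqrt (E s + \<eta>)) has_real_derivative inverse (sqrt (E s + \<eta>)) / 2 * E' s) (at s within {0..T})"
        using pos[OF sT] \<eta> E[OF sT] by (intro DERIV_chain2[OF DERIV_real_sqrt]) (auto intro!: derivative_eq_intros)
      moreover have "(G has_real_derivative \<beta> s) (at s within {0..T})"
        unfolding G_def using \<beta>(1) sT by (rule integral_has_real_derivative)
      ultimately have "((\<lambda>s. sqrt (E s + \<eta>) - G s) has_real_derivative
          inverse (sqrt (E s + \<eta>)) / 2 * E' s - \<beta> s) (at s within {0..T})"
        by (rule DERIV_diff)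
      then show ?thesis
        using t by (auto simp: mult.commute intro: DERIV_subset)
    qed
    obtain s where s: "s \<in> {0<..<t}"
      "(sqrt (E t + \<eta>) - G t) - (sqrt (E 0 + \<eta>) - G 0) = (E' s * (inverse (sqrt (E s + \<eta>)) / 2) - \<beta> s) * (t - 0)"
      using mvt_simple[OF t0, of "\<lambda>s. sqrt (E s + \<eta>) - G s" "\<lambda>s x. (E' s * (inverse (sqrt (E s + \<eta>)) / 2) - \<beta> s) * x"]
        der by (auto simp: has_field_derivative_def)
    have sT: "s \<in> {0..T}" using s t by auto
    have r: "0 < sqrt (E s + \<eta>)" using pos[OF sT] \<eta> by simp
    have "E' s \<le> 2 * \<beta> s * sqrt (E s + \<eta>)"
      using le[OF sT] \<beta>(2)[OF sT] \<eta> by (smt (verit) mult_left_mono real_sqrt_le_mono)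
    then have "E' s * (inverse (sqrt (E s + \<eta>)) / 2) \<le> \<beta> s"
      using r by (simp add: field_simps)
    then have "(E' s * (inverse (sqrt (E s + \<eta>)) / 2) - \<beta> s) * (t - 0) \<le> 0"
      using t0 by (intro mult_nonpos_nonneg) auto
    then show ?thesis using s(2) by (simp add: G_def)
  qed
  have "((\<lambda>\<eta>. sqrt (E t + \<eta>)) \<longlongrightarrow> sqrt (E t + 0)) (at_right 0)"
    "((\<lambda>\<eta>. sqrt (E 0 + \<eta>) + G t) \<longlongrightarrow> sqrt (E 0 + 0) + G t) (at_right 0)"
    by (intro tendsto_intros)+
  then have "sqrt (E t + 0) \<le> sqrt (E 0 + 0) + G t"
    using step by (intro tendsto_le[OF trivial_limit_at_right_real]) (auto simp: eventually_at_filter)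
  then have "(sqrt (E t))\<^sup>2 \<le> (sqrt (E 0) + G t)\<^sup>2"
    using pos[OF t] by (intro power_mono) auto
  then show ?thesis using pos[OF t] by (simp add: G_def)
qed


section \<open>The finite element space\<close>

text \<open>For a short vector \<open>e\<close> and \<open>z\<close> in the half ball, \<open>A e = w (z + e) - w z\<close>, because both points
  lie in the ball where \<open>w\<close> is affine. Integrating \<open>\<parallel>A e\<parallel>\<^sup>2 \<le> 2 \<parallel>w (z + e)\<parallel>\<^sup>2 + 2 \<parallel>w z\<parallel>\<^sup>2\<close> over \<open>z\<close> and
  using translation invariance bounds \<open>\<parallel>A e\<parallel>\<close> by the \<open>L\<^sup>2\<close> norm of \<open>w\<close>; homogeneity extends this to
  all \<open>e\<close>.\<close>

lemma affine_slope_bound: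
  fixes w :: "'a::euclidean_space \<Rightarrow> 'b::euclidean_space"
  assumes int: "integrable lborel (\<lambda>x. (norm (w x))\<^sup>2)"
    and "linear A" "0 < r" and w: "\<And>x. x \<in> ball c r \<Longrightarrow> w x = A x + d"
  shows "norm (A e) \<le>
    4 / (r * sqrt (measure lborel (ball c (r/2)))) * sqrt (LINT x|lborel. (norm (w x))\<^sup>2) * norm e"
proof -
  define I m where "I = (LINT x|lborel. (norm (w x))\<^sup>2)" and "m = measure lborel (ball c (r/2))"
  have "0 < m" unfolding m_def using assms(3) by (simp add: content_ball_pos)
  have I: "0 \<le> I" unfolding I_def by simp
  have small: "norm (A e) \<le> 2 * sqrt (I / m)" if e: "norm e \<le> r/2" for e
  proof -
    have shift: "integrable lborel (\<lambda>x. (norm (w (e + x)))\<^sup>2)" "(LINT x|lborel. (norm (w (e + x)))\<^sup>2) = I"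
    proof -
      have m: "(+) e \<in> lborel \<rightarrow>\<^sub>M borel" by simp
      have b: "(\<lambda>x. (norm (w x))\<^sup>2) \<in> borel_measurable borel" using int by auto
      show "integrable lborel (\<lambda>x. (norm (w (e + x)))\<^sup>2)"
        using integrable_distr_eq[OF m b] int by (simp add: lborel_distr_plus)
      show "(LINT x|lborel. (norm (w (e + x)))\<^sup>2) = I"
        using integral_distr[OF m b] by (simp add: lborel_distr_plus I_def)
    qed
    have "(norm (A e))\<^sup>2 * m = (LINT z|lborel. (norm (A e))\<^sup>2 * indicator (ball c (r/2)) z)"
      by (simp add: m_def)
    also have "\<dots> \<le> (LINT z|lborel. 2 * (norm (w (e + z)))\<^sup>2 + 2 * (norm (w z))\<^sup>2)"
    proof (rule integral_mono)
      show "integrable lborel (\<lambda>z. (norm (A e))\<^sup>2 * indicator (ball c (r/2)) z)"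
        using emeasure_lborel_ball_finite[of c "r/2"] by (intro integrable_mult_right integrable_real_indicator) (auto simp: top.not_eq_extremum)
      show "integrable lborel (\<lambda>z. 2 * (norm (w (e + z)))\<^sup>2 + 2 * (norm (w z))\<^sup>2)"
        using shift int by simp
      fix z
      show "(norm (A e))\<^sup>2 * indicator (ball c (r/2)) z \<le> 2 * (norm (w (e + z)))\<^sup>2 + 2 * (norm (w z))\<^sup>2"
      proof (cases "z \<in> ball c (r/2)")
        case True
        then have "z \<in> ball c r" using assms(3) by auto
        moreover have "e + z \<in> ball c r"
          using True e norm_triangle_ineq4[of "c - z" e] by (simp add: dist_norm algebra_simps)
        ultimately have "A e = w (e + z) - w z"
          using w linear_add[OF assms(2)] by simp
        then have "norm (A e) \<le> norm (w (e + z)) + norm (w z)"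
          using norm_triangle_ineq4 by simp
        then have "(norm (A e))\<^sup>2 \<le> (norm (w (e + z)) + norm (w z))\<^sup>2" by (intro power_mono) auto
        also have "\<dots> \<le> 2 * (norm (w (e + z)))\<^sup>2 + 2 * (norm (w z))\<^sup>2"
          using sum_squares_bound[of "norm (w (e + z))" "norm (w z)"] by (simp add: power2_sum)
        finally show ?thesis using True by simp
      qed simp
    qed
    also have "\<dots> = 4 * I" using shift int by (simp add: I_def)
    finally have "(norm (A e))\<^sup>2 \<le> 4 * (I / m)" using \<open>0 < m\<close> by (simp add: field_simps)
    then have "norm (A e) \<le> sqrt (4 * (I / m))" by (rule real_le_rsqrt)
    then show ?thesis by (simp only: real_sqrt_mult real_sqrt_four)
  qed
  show ?thesis
  proof (cases "e = 0")
    case True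
    then show ?thesis using linear_0[OF assms(2)] by simp
  next
    case False
    have "norm (A ((r / (2 * norm e)) *\<^sub>R e)) \<le> 2 * sqrt (I / m)"
      using False assms(3) by (intro small) simp
    then have "r / (2 * norm e) * norm (A e) \<le> 2 * (sqrt I / sqrt m)"
      using False assms(3) by (simp add: linear_scale[OF assms(2)] real_sqrt_divide)
    then have "norm (A e) \<le> 4 / (r * sqrt m) * sqrt I * norm e"
      using False assms(3) \<open>0 < m\<close> by (simp add: field_simps)
    then show ?thesis by (simp add: I_def m_def)
  qed
qed

text \<open>The segment from \<open>x\<close> to \<open>y\<close> is covered by finitely many closed sets on which \<open>w\<close> is
  \<open>L\<close>-Lipschitz: the traces of the elements and the zero set of \<open>w\<close>, which contains everything
  outside the mesh. Continuity of \<open>w\<close> lets these estimates be chained along the segment.\<close>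

lemma piecewise_lipschitz_bound:
  fixes w :: "'a::real_normed_vector \<Rightarrow> 'b::real_normed_vector"
  assumes cont: "continuous_on UNIV w" and fin: "finite \<T>" and closed: "\<And>K. K \<in> \<T> \<Longrightarrow> closed K"
    and L: "0 \<le> L" "\<And>K x y. K \<in> \<T> \<Longrightarrow> x \<in> K \<Longrightarrow> y \<in> K \<Longrightarrow> norm (w y - w x) \<le> L * norm (y - x)"
    and zero: "\<And>x. x \<notin> \<Union>\<T> \<Longrightarrow> w x = 0"
  shows "norm (w y - w x) \<le> L * norm (y - x)"
proof -
  define p where "p \<tau> = x + \<tau> *\<^sub>R (y - x)" for \<tau> :: real
  have p: "continuous_on UNIV p" unfolding p_def by (intro continuous_intros)
  have wp: "continuous_on UNIV (\<lambda>\<tau>. w (p \<tau>))"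
    using continuous_on_compose2[OF cont p] by simp
  have pd: "norm (p s - p t) = \<bar>s - t\<bar> * norm (y - x)" for s t
    by (simp add: p_def flip: scaleR_left_diff_distrib)
  define Z where "Z = {\<tau>. w (p \<tau>) = 0}"
  have "closed Z" unfolding Z_def
    using continuous_closed_preimage_constant[OF wp closed_UNIV, of 0] by simp
  have "(L * norm (y - x))-lipschitz_on {0..1} (\<lambda>\<tau>. w (p \<tau>))"
  proof (rule lipschitz_on_closed_Union[where I = "insert Z ((\<lambda>K. p -` K) ` \<T>)" and U = id])
    fix i assume i: "i \<in> insert Z ((\<lambda>K. p -` K) ` \<T>)"
    show "closed (id i)"
      using i \<open>closed Z\<close> closed p by (auto intro: continuous_closed_vimage simp: continuous_on_eq_continuous_at)
    show "(L * norm (y - x))-lipschitz_on (id i) (\<lambda>\<tau>. w (p \<tau>))"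
    proof (rule lipschitz_onI)
      fix s t assume "s \<in> id i" "t \<in> id i"
      then have "norm (w (p s) - w (p t)) \<le> L * norm (p s - p t)"
        using i L by (auto simp: Z_def)
      then show "dist (w (p s)) (w (p t)) \<le> L * norm (y - x) * dist s t"
        by (simp add: dist_norm pd mult_ac)
    qed (use L in auto)
  next
    show "{0..1} \<subseteq> (\<Union>i\<in>insert Z ((\<lambda>K. p -` K) ` \<T>). id i)"
      using zero by (auto simp: Z_def)
  qed (use fin L in auto)
  then have "dist (w (p 1)) (w (p 0)) \<le> L * norm (y - x) * dist (1::real) 0"
    by (rule lipschitz_onD) auto
  then show ?thesis by (simp add: p_def dist_norm)
qed

text \<open>These are the only properties of the finite element space on which the energy argument relies.
  Closure under the combinations in \<open>difference_quotient_mem\<close> is what makes the Lipschitz bound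
  applicable to the error of a time difference quotient; it stands in for being a linear
  subspace.\<close>

locale uniformly_lipschitz_space =
  fixes D :: "(real^'d) set" and V :: "(real^'d \<Rightarrow> real^'d) set" and R C :: real
  assumes open_D: "open D" and R_pos: "0 < R" and C_nonneg: "0 \<le> C"
    and zero_outside: "w \<in> V \<Longrightarrow> x \<notin> D \<or> R \<le> norm x \<Longrightarrow> w x = 0"
    and lipschitz: "w \<in> V \<Longrightarrow> norm (w y - w x) \<le> C * L2_norm D w * norm (y - x)"
    and difference_quotient_mem:
      "w1 \<in> V \<Longrightarrow> w2 \<in> V \<Longrightarrow> w3 \<in> V \<Longrightarrow> (\<lambda>x. (w1 x - w2 x) /\<^sub>R c - w3 x) \<in> V"

lemma L2_norm_eq_lborel:
  fixes w :: "real^'d \<Rightarrow> real^'d"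
  assumes "open D" "w \<in> borel_measurable borel" "\<And>x. x \<notin> D \<Longrightarrow> w x = 0"
  shows "L2_norm D w = sqrt (LINT x|lborel. (norm (w x))\<^sup>2)"
  unfolding L2_norm_def L2_inner_def power2_norm_eq_inner
  using assms by (subst lebesgue_on_integral_eq_lborel) auto

text \<open>Every element is a full-dimensional simplex and so contains a ball, on which the slope of the
  affine piece is controlled by the \<open>L\<^sup>2\<close> norm. The mesh is finite, so the sum of the element
  constants serves as a common one.\<close>

lemma P1_space_uniformly_lipschitz:
  fixes D :: "(real^'d) set"
  assumes D: "open D" and mesh: "shape_regular_mesh D \<sigma> h \<T>"
  shows "\<exists>R C. uniformly_lipschitz_space D (P1_space D \<T>) R C"
proof -
  have fin: "finite \<T>" and simp: "\<And>K. K \<in> \<T> \<Longrightarrow> int CARD('d) simplex K"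
    using mesh by (auto simp: shape_regular_mesh_def triangulation_def)
  have cl: "\<And>K. K \<in> \<T> \<Longrightarrow> closed K" using simp closed_simplex by blast
  have comp: "compact (\<Union>\<T>)" using fin simp compact_simplex by (intro compact_Union) auto
  then obtain R where R: "0 < R" "\<And>x. x \<in> \<Union>\<T> \<Longrightarrow> norm x < R"
    using compact_imp_bounded[OF comp] by (auto simp: bounded_pos_less)
  have ex: "\<exists>L\<ge>0. \<forall>w\<in>P1_space D \<T>. \<forall>x\<in>K. \<forall>y\<in>K. norm (w y - w x) \<le> L * L2_norm D w * norm (y - x)"
    if K: "K \<in> \<T>" for K
  proof -
    have "convex K" using simp[OF K] by (auto simp: simplex_def)
    moreover have "aff_dim K = DIM(real^'d)" using aff_dim_simplex[OF simp[OF K]] by simp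
    moreover have "K \<noteq> {}" using simp[OF K] by (auto simp: simplex_def)
    ultimately have "interior K \<noteq> {}"
      using interior_rel_interior rel_interior_eq_empty by metis
    then obtain c where "c \<in> interior K" by blast
    then obtain r where r: "0 < r" "ball c r \<subseteq> K" by (auto simp: mem_interior)
    define L where "L = 4 / (r * sqrt (measure lborel (ball c (r/2))))"
    have "norm (w y - w x) \<le> L * L2_norm D w * norm (y - x)"
      if w: "w \<in> P1_space D \<T>" and xy: "x \<in> K" "y \<in> K" for w x y
    proof -
      have w0: "w x = 0" if "x \<notin> D \<or> x \<notin> \<Union>\<T>" for x using w that by (auto simp: P1_space_def)
      have wc: "continuous_on UNIV w" using w by (auto simp: P1_space_def)
      then have wm: "w \<in> borel_measurable borel" by (rule borel_measurable_continuous_onI)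
      have "bounded (w ` \<Union>\<T>)"
        using comp wc by (intro compact_imp_bounded compact_continuous_image) (auto intro: continuous_on_subset)
      then obtain b where b: "\<And>x. x \<in> \<Union>\<T> \<Longrightarrow> norm (w x) \<le> b" by (auto simp: bounded_iff)
      have "integrable lborel (\<lambda>x. (norm (w x))\<^sup>2)"
      proof (rule integrable_bounded_finite_support(1)[where A = "\<Union>\<T>" and c = "b\<^sup>2"])
        show "\<Union>\<T> \<in> sets lborel" using comp by (simp add: borel_compact)
        show "emeasure lborel (\<Union>\<T>) < \<infinity>" by (intro emeasure_compact_finite comp)
        show "\<bar>(norm (w x))\<^sup>2\<bar> \<le> b\<^sup>2" if "x \<in> \<Union>\<T>" for x
          using power_mono[OF b[OF that] norm_ge_zero, of 2] by simp
      qed (use wm w0 in auto)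
      moreover obtain A d where A: "linear A" "\<And>x. x \<in> K \<Longrightarrow> w x = A x + d"
        using w K by (auto simp: P1_space_def)
      ultimately have "norm (A (y - x)) \<le> L * sqrt (LINT x|lborel. (norm (w x))\<^sup>2) * norm (y - x)"
        unfolding L_def using r by (intro affine_slope_bound) auto
      moreover have "w y - w x = A (y - x)" using A xy by (simp add: linear_diff)
      ultimately show ?thesis using L2_norm_eq_lborel[OF D wm] w0 by simp
    qed
    moreover have "0 \<le> L" unfolding L_def using r(1) by simp
    ultimately show ?thesis by blast
  qed
  then obtain L where L: "\<And>K. K \<in> \<T> \<Longrightarrow> 0 \<le> L K"
    "\<And>K w x y. K \<in> \<T> \<Longrightarrow> w \<in> P1_space D \<T> \<Longrightarrow> x \<in> K \<Longrightarrow> y \<in> K \<Longrightarrow> norm (w y - w x) \<le> L K * L2_norm D w * norm (y - x)"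
    by metis
  define C where "C = sum L \<T>"
  have C: "0 \<le> C" "\<And>K. K \<in> \<T> \<Longrightarrow> L K \<le> C"
    unfolding C_def using L(1) fin by (auto intro: sum_nonneg member_le_sum)
  have "uniformly_lipschitz_space D (P1_space D \<T>) R C"
  proof
    fix w x assume "w \<in> P1_space D \<T>" "x \<notin> D \<or> R \<le> norm x"
    then show "w x = 0" using R(2)[of x] unfolding P1_space_def by fastforce
  next
    fix w x y assume w: "w \<in> P1_space D \<T>"
    show "norm (w y - w x) \<le> C * L2_norm D w * norm (y - x)"
    proof (rule piecewise_lipschitz_bound[OF _ fin cl])
      fix K x y assume K: "K \<in> \<T>" "x \<in> K" "y \<in> K"
      have "L K * L2_norm D w * norm (y - x) \<le> C * L2_norm D w * norm (y - x)"
        using C(2)[OF K(1)] by (intro mult_right_mono L2_norm_nonneg) auto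
      then show "norm (w y - w x) \<le> C * L2_norm D w * norm (y - x)"
        using L(2)[OF K(1) w K(2,3)] by linarith
    qed (use w C(1) L2_norm_nonneg[of D w] in \<open>auto simp: P1_space_def\<close>)
  next
    fix w1 w2 w3 :: "real^'d \<Rightarrow> real^'d" and c :: real
    assume w: "w1 \<in> P1_space D \<T>" "w2 \<in> P1_space D \<T>" "w3 \<in> P1_space D \<T>"
    have "\<exists>A d. linear A \<and> (\<forall>x\<in>K. (w1 x - w2 x) /\<^sub>R c - w3 x = A x + d)" if K: "K \<in> \<T>" for K
    proof -
      obtain A1 d1 A2 d2 A3 d3 where
        "linear A1" "linear A2" "linear A3"
        and e: "\<And>x. x \<in> K \<Longrightarrow> w1 x = A1 x + d1" "\<And>x. x \<in> K \<Longrightarrow> w2 x = A2 x + d2" "\<And>x. x \<in> K \<Longrightarrow> w3 x = A3 x + d3"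
        using w K by (auto simp: P1_space_def) metis
      then have "linear (\<lambda>x. inverse c *\<^sub>R (A1 x - A2 x) - A3 x)"
        by (intro linear_compose_sub linear_compose_scale_right)
      moreover have "(w1 x - w2 x) /\<^sub>R c - w3 x =
          (inverse c *\<^sub>R (A1 x - A2 x) - A3 x) + (inverse c *\<^sub>R (d1 - d2) - d3)" if "x \<in> K" for x
        by (simp add: e[OF that] algebra_simps)
      ultimately show ?thesis by blast
    qed
    moreover have "continuous_on UNIV (\<lambda>x. (w1 x - w2 x) /\<^sub>R c - w3 x)"
      using w by (intro continuous_intros) (auto simp: P1_space_def)
    ultimately show "(\<lambda>x. (w1 x - w2 x) /\<^sub>R c - w3 x) \<in> P1_space D \<T>"
      using w by (auto simp: P1_space_def)
  qed (use D R C in auto)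
  then show ?thesis by blast
qed


section \<open>Differentiating an energy along a path in the space\<close>

lemma strain_difference_quotient:
  "strain y x (\<lambda>z. (w1 z - w2 z) /\<^sub>R a - w3 z) = (strain y x w1 - strain y x w2) / a - strain y x w3"
  unfolding strain_def
  by (simp add: inner_diff_left inner_diff_right divide_inverse_commute algebra_simps)

context uniformly_lipschitz_space
begin

lemma measurable_V:
  assumes "w \<in> V"
  shows "w \<in> borel_measurable borel"
proof -
  have "(C * L2_norm D w)-lipschitz_on UNIV w"
    using lipschitz[OF assms] C_nonneg L2_norm_nonneg[of D w]
    by (intro lipschitz_onI) (auto simp: dist_norm)
  then show ?thesis by (intro borel_measurable_continuous_onI lipschitz_on_continuous_on)
qed

lemma component_measurable_V:
  assumes "w \<in> V"
  shows "(\<lambda>x. w x $ i) \<in> borel_measurable borel"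
  using measurable_V[OF assms] by (simp add: cart_eq_inner_axis)

text \<open>Every function of the space vanishes on the sphere of radius \<open>R\<close>, and a point of the ball has
  distance at most \<open>2 R\<close> from that sphere.\<close>

lemma sup_bound:
  assumes "w \<in> V"
  shows "norm (w x) \<le> C * L2_norm D w * (2 * R)"
proof (cases "norm x < R")
  case True
  obtain y :: "real^'d" where y: "norm y = R" using vector_choose_size[of R] R_pos by auto
  have "norm (w x) = norm (w y - w x)" using zero_outside[OF assms, of y] y by simp
  also have "\<dots> \<le> C * L2_norm D w * norm (y - x)" by (rule lipschitz[OF assms])
  also have "\<dots> \<le> C * L2_norm D w * (2 * R)"
    using True y norm_triangle_ineq4[of y x] C_nonneg L2_norm_nonneg[of D w] by (intro mult_left_mono) auto
  finally show ?thesis .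
next
  case False
  then show ?thesis using zero_outside[OF assms, of x] C_nonneg R_pos L2_norm_nonneg[of D w] by simp
qed

lemma strain_bound:
  assumes "w \<in> V"
  shows "\<bar>strain y x w\<bar> \<le> C * L2_norm D w"
proof (cases "y = x")
  case False
  have "\<bar>strain y x w\<bar> \<le> norm ((w y - w x) /\<^sub>R norm (y - x)) * norm ((y - x) /\<^sub>R norm (y - x))"
    unfolding strain_def by (rule Cauchy_Schwarz_ineq2)
  also have "\<dots> = norm (w y - w x) / norm (y - x)" using False by (simp add: divide_inverse_commute)
  also have "\<dots> \<le> C * L2_norm D w" using lipschitz[OF assms, of y x] False by (simp add: divide_le_eq)
  finally show ?thesis .
qed (use C_nonneg L2_norm_nonneg[of D w] in \<open>simp add: strain_def\<close>)

lemma L2_inner_eq_sum: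
  assumes "w1 \<in> V" "w2 \<in> V"
  shows "L2_inner D w1 w2 = (\<Sum>i\<in>UNIV. LINT x|lborel. w1 x $ i * w2 x $ i)"
proof -
  note [measurable] = measurable_V[OF assms(1)] measurable_V[OF assms(2)]
  have "L2_inner D w1 w2 = (LINT x|lborel. w1 x \<bullet> w2 x)"
    unfolding L2_inner_def using open_D zero_outside[OF assms(1)]
    by (intro lebesgue_on_integral_eq_lborel) auto
  also have "\<dots> = (LINT x|lborel. (\<Sum>i\<in>UNIV. w1 x $ i * w2 x $ i))" by (simp add: inner_vec_def)
  also have "\<dots> = (\<Sum>i\<in>UNIV. LINT x|lborel. w1 x $ i * w2 x $ i)"
  proof (rule Bochner_Integration.integral_sum)
    fix i
    show "integrable lborel (\<lambda>x. w1 x $ i * w2 x $ i)"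
    proof (rule integrable_bounded_finite_support(1)[where A = "ball 0 R" and c = "(C * L2_norm D w1 * (2 * R)) * (C * L2_norm D w2 * (2 * R))"])
      show "emeasure lborel (ball (0::real^'d) R) < \<infinity>"
        using emeasure_lborel_ball_finite[of 0 R] by (auto simp: top.not_eq_extremum)
      show "(\<lambda>x. w1 x $ i * w2 x $ i) \<in> borel_measurable lborel"
        using component_measurable_V assms by (intro borel_measurable_times) simp_all
      fix x :: "real^'d"
      show "\<bar>w1 x $ i * w2 x $ i\<bar> \<le> (C * L2_norm D w1 * (2 * R)) * (C * L2_norm D w2 * (2 * R))"
        unfolding abs_mult
        using order_trans[OF component_le_norm_cart sup_bound[OF assms(1)]] order_trans[OF component_le_norm_cart sup_bound[OF assms(2)]]
          C_nonneg R_pos L2_norm_nonneg[of D w1]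
        by (intro mult_mono) auto
    qed (use zero_outside[OF assms(1)] in \<open>auto simp: not_less\<close>)
  qed
  finally show ?thesis .
qed

lemma V_subset_L2:
  assumes "w \<in> V"
  shows "w \<in> L2_on D"
proof -
  note [measurable] = measurable_V[OF assms]
  have i: "integrable lborel (\<lambda>x. (norm (w x))\<^sup>2)"
  proof (rule integrable_bounded_finite_support(1)[where A = "ball 0 R" and c = "(C * L2_norm D w * (2 * R))\<^sup>2"])
    show "emeasure lborel (ball (0::real^'d) R) < \<infinity>"
      using emeasure_lborel_ball_finite[of 0 R] by (auto simp: top.not_eq_extremum)
    show "\<bar>(norm (w x))\<^sup>2\<bar> \<le> (C * L2_norm D w * (2 * R))\<^sup>2" for x
      using power_mono[OF sup_bound[OF assms] norm_ge_zero, of x 2] by simp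
  qed (use zero_outside[OF assms] in \<open>auto simp: not_less\<close>)
  have "(\<lambda>x. indicator D x *\<^sub>R (norm (w x))\<^sup>2) = (\<lambda>x. (norm (w x))\<^sup>2)"
    using zero_outside[OF assms] by (force simp: indicator_def)
  then have "integrable (lebesgue_on D) (\<lambda>x. (norm (w x))\<^sup>2)"
    using open_D i by (subst integrable_restrict_space) (auto simp: integrable_completion)
  moreover have "w \<in> borel_measurable (lebesgue_on D)"
    using measurable_V[OF assms] by (intro measurable_restrict_space1 measurable_completion) simp
  ultimately show ?thesis by (simp add: L2_on_def)
qed

text \<open>Here \<open>l\<close> is a linear observation of the displacement that is controlled by its \<open>L\<^sup>2\<close> norm. The
  function \<open>(u s - u t) / (s - t) - v t\<close> again belongs to \<open>V\<close>, so its \<open>L\<^sup>2\<close> norm, which tends to 0,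
  bounds the error of the difference quotient of \<open>l \<circ> u\<close> uniformly.\<close>

lemma observed_potential_has_derivative:
  fixes l :: "(real^'d \<Rightarrow> real^'d) \<Rightarrow> 'p \<Rightarrow> real"
  assumes f: "lipschitz_potential K f" and M: "0 \<le> M"
    and W: "W \<in> borel_measurable N" "\<And>p. 0 \<le> W p" "\<And>p. W p \<le> M"
    and A: "A \<in> sets N" "emeasure N A < \<infinity>" and t: "t \<in> I"
    and uv: "\<And>s. s \<in> I \<Longrightarrow> u s \<in> V" "\<And>s. s \<in> I \<Longrightarrow> v s \<in> V" "has_L2_time_derivative D I u v"
    and l: "\<And>w. w \<in> V \<Longrightarrow> l w \<in> borel_measurable N"
      "\<And>w p. w \<in> V \<Longrightarrow> p \<in> A \<Longrightarrow> \<bar>l w p\<bar> \<le> c * L2_norm D w"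
      "\<And>w p. w \<in> V \<Longrightarrow> p \<notin> A \<Longrightarrow> W p = 0 \<or> l w p = 0"
      "\<And>w1 w2 w3 a p. w1 \<in> V \<Longrightarrow> w2 \<in> V \<Longrightarrow> w3 \<in> V \<Longrightarrow>
         l (\<lambda>x. (w1 x - w2 x) /\<^sub>R a - w3 x) p = (l w1 p - l w2 p) / a - l w3 p"
  shows "((\<lambda>s. \<integral>p. W p * f (l (u s) p) \<partial>N) has_real_derivative
           (\<integral>p. W p * deriv f (l (u t) p) * l (v t) p \<partial>N)) (at t within I)"
proof (rule weighted_potential_has_derivative[OF f M W A t,
      where B = "\<lambda>s. c * L2_norm D (u s)" and B' = "c * L2_norm D (v t)"
        and e = "\<lambda>s. c * L2_norm D (\<lambda>x. (u s x - u t x) /\<^sub>R (s - t) - v t x)"])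
  fix s p assume s: "s \<in> I" "p \<in> A"
  show "\<bar>(l (u s) p - l (u t) p) / (s - t) - l (v t) p\<bar>
      \<le> c * L2_norm D (\<lambda>x. (u s x - u t x) /\<^sub>R (s - t) - v t x)"
    using l(2)[OF difference_quotient_mem[OF uv(1)[OF s(1)] uv(1)[OF t] uv(2)[OF t]] s(2)]
      l(4)[OF uv(1)[OF s(1)] uv(1)[OF t] uv(2)[OF t]] by simp
next
  have "((\<lambda>s. L2_norm D (\<lambda>x. (u s x - u t x) /\<^sub>R (s - t) - v t x)) \<longlongrightarrow> 0) (at t within I)"
    using uv(3) t by (auto simp: has_L2_time_derivative_def)
  then show "((\<lambda>s. c * L2_norm D (\<lambda>x. (u s x - u t x) /\<^sub>R (s - t) - v t x)) \<longlongrightarrow> 0) (at t within I)"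
    by (rule tendsto_mult_right_zero)
qed (use uv t l in auto)

text \<open>The kinetic energy is the sum over the components of integrals of the potential \<open>r\<^sup>2 / 2\<close>,
  observed through the components of the velocity.\<close>

lemma kinetic_energy_has_derivative:
  assumes "t \<in> I"
    and va: "\<And>s. s \<in> I \<Longrightarrow> v s \<in> V" "\<And>s. s \<in> I \<Longrightarrow> a s \<in> V" "has_L2_time_derivative D I v a"
  shows "((\<lambda>s. 1 / 2 * (L2_norm D (v s))\<^sup>2) has_real_derivative L2_inner D (a t) (v t)) (at t within I)"
proof -
  define q :: "real \<Rightarrow> real" where "q r = 1 * r\<^sup>2 / 2" for r
  have q: "lipschitz_potential 1 q" "\<And>r. deriv q r = r"
    using quadratic_lipschitz_potential[of 1 q] by (auto simp: q_def)
  have "((\<lambda>s. LINT x|lborel. 1 * q (v s x $ i)) has_real_derivative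
      (LINT x|lborel. 1 * deriv q (v t x $ i) * (a t x $ i))) (at t within I)" for i
  proof (rule observed_potential_has_derivative[OF q(1), where l = "\<lambda>w x. w x $ i" and M = 1 and A = "ball 0 R"
        and u = v and v = a and c = "C * (2 * R)"])
    show "emeasure lborel (ball (0::real^'d) R) < \<infinity>"
      using emeasure_lborel_ball_finite[of 0 R] by (auto simp: top.not_eq_extremum)
    show "(\<lambda>x. w x $ i) \<in> borel_measurable lborel" if "w \<in> V" for w
      using component_measurable_V[OF that] by simp
    show "\<bar>w x $ i\<bar> \<le> C * (2 * R) * L2_norm D w" if "w \<in> V" for w x
      using order_trans[OF component_le_norm_cart sup_bound[OF that]] by (simp add: mult_ac)
    show "(1::real) = 0 \<or> w x $ i = 0" if "w \<in> V" "x \<notin> ball 0 R" for w x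
      using zero_outside[OF that(1), of x] that(2) by simp
  qed (use assms in \<open>auto simp: divide_inverse_commute\<close>)
  then have "((\<lambda>s. \<Sum>i\<in>UNIV. LINT x|lborel. 1 * q (v s x $ i)) has_real_derivative
      (\<Sum>i\<in>UNIV. LINT x|lborel. 1 * deriv q (v t x $ i) * (a t x $ i))) (at t within I)"
    by (intro DERIV_sum)
  moreover have "(\<Sum>i\<in>UNIV. LINT x|lborel. 1 * deriv q (v t x $ i) * (a t x $ i)) = L2_inner D (a t) (v t)"
    using va assms(1) by (simp add: L2_inner_eq_sum q(2) mult.commute)
  moreover have "(\<Sum>i\<in>UNIV. LINT x|lborel. 1 * q (v s x $ i)) = 1 / 2 * (L2_norm D (v s))\<^sup>2" if "s \<in> I" for s
    unfolding L2_norm_power2 L2_inner_eq_sum[OF va(1)[OF that] va(1)[OF that]]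
    by (simp add: q_def power2_eq_square sum_divide_distrib)
  ultimately show ?thesis
    using assms(1) by (auto intro: has_field_derivative_transform_within[where d = 1])
qed

end

section \<open>The peridynamic energy and its derivative\<close>

text \<open>The derivative of \<open>\<omega>\<close> makes it continuous on the open set \<open>D\<close>; elsewhere it is zero.\<close>

lemma boundary_function_measurable:
  fixes \<omega> :: "real^'d \<Rightarrow> real"
  assumes "open D" "boundary_function D \<delta> \<omega>"
  shows "\<omega> \<in> borel_measurable borel"
proof -
  have z: "\<And>x. x \<notin> D \<Longrightarrow> \<omega> x = 0" using assms(2) by (simp add: boundary_function_def)
  obtain \<omega>' where "\<And>x. x \<in> D \<Longrightarrow> (\<omega> has_derivative blinfun_apply (\<omega>' x)) (at x)"
    using assms(2) unfolding boundary_function_def by blast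
  then have "continuous_on D \<omega>"
    by (meson continuous_at_imp_continuous_on has_derivative_continuous)
  then have "(\<lambda>x. indicator D x *\<^sub>R \<omega> x) \<in> borel_measurable borel"
    using assms(1) by (intro borel_measurable_continuous_on_indicator) auto
  also have "(\<lambda>x. indicator D x *\<^sub>R \<omega> x) = \<omega>" using z by (force simp: indicator_def)
  finally show ?thesis .
qed

locale peridynamic_material = uniformly_lipschitz_space D V R C
  for D :: "(real^'d) set" and V R C +
  fixes \<epsilon> M :: real and J :: "real \<Rightarrow> real" and \<omega> :: "real^'d \<Rightarrow> real"
  assumes \<epsilon>_pos: "0 < \<epsilon>" and influence: "influence_function M J"
    and \<omega>_measurable [measurable]: "\<omega> \<in> borel_measurable borel"
    and \<omega>_bounds: "0 \<le> \<omega> x" "\<omega> x \<le> 1"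
    and \<omega>_outside: "x \<notin> D \<Longrightarrow> \<omega> x = 0"
begin

definition pair_weight :: "(real^'d) \<times> (real^'d) \<Rightarrow> real" where
  "pair_weight p = \<omega> (fst p) * \<omega> (snd p) * J (norm (snd p - fst p) / \<epsilon>)"

definition pair_strain :: "(real^'d \<Rightarrow> real^'d) \<Rightarrow> (real^'d) \<times> (real^'d) \<Rightarrow> real" where
  "pair_strain w p = sqrt (norm (snd p - fst p)) * strain (snd p) (fst p) w"

lemma M_nonneg: "0 \<le> M"
  using influence unfolding influence_function_def by (metis order_refl order_trans zero_less_one)

lemma J_bounds: "0 \<le> r \<Longrightarrow> 0 \<le> J r" "0 \<le> r \<Longrightarrow> J r \<le> M"
  using influence M_nonneg unfolding influence_function_def by (metis leI order_refl)+

lemma J_zero: "\<epsilon> \<le> r \<Longrightarrow> J (r / \<epsilon>) = 0"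
  using influence \<epsilon>_pos by (simp add: influence_function_def)

text \<open>\<open>J\<close> is measurable only on the nonnegative half-line, where its argument lies, so it is first cut
  off to a Borel function on the whole line.\<close>

lemma J_measurable [measurable]:
  "(\<lambda>p. J (norm (snd p - fst p) / \<epsilon>)) \<in> borel_measurable (borel \<Otimes>\<^sub>M (borel :: (real^'d) measure))"
proof -
  have [measurable]: "(\<lambda>r. indicator {0..} r *\<^sub>R J r) \<in> borel_measurable borel"
    using influence by (simp add: influence_function_def borel_measurable_restrict_space_iff)
  have "(\<lambda>p::(real^'d)\<times>(real^'d). indicator {0..} (norm (snd p - fst p) / \<epsilon>) *\<^sub>R J (norm (snd p - fst p) / \<epsilon>))
      \<in> borel_measurable (borel \<Otimes>\<^sub>M borel)"
    by (rule measurable_compose[OF _ \<open>(\<lambda>r. indicator {0..} r *\<^sub>R J r) \<in> borel_measurable borel\<close>]) measurable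
  then show ?thesis using \<epsilon>_pos by simp
qed

lemma strain_measurable:
  assumes "w \<in> V"
  shows "(\<lambda>p. strain (snd p) (fst p) w) \<in> borel_measurable (borel \<Otimes>\<^sub>M borel)"
proof -
  note [measurable] = measurable_V[OF assms]
  show ?thesis unfolding strain_def by measurable
qed

text \<open>If one of two points closer than the horizon has norm at least \<open>R + \<epsilon>\<close>, then both lie outside
  the ball of radius \<open>R\<close>, which contains the supports of all functions of the space.\<close>

lemma strain_eq_zero:
  assumes "w \<in> V" "R + \<epsilon> \<le> norm x \<or> R + \<epsilon> \<le> norm y" "norm (y - x) < \<epsilon>"
  shows "strain y x w = 0"
proof -
  have "R \<le> norm x" "R \<le> norm y"
    using assms(2,3) norm_triangle_ineq2[of x y] norm_triangle_ineq2[of y x] \<epsilon>_pos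
    by (auto simp: norm_minus_commute)
  then show ?thesis using zero_outside[OF assms(1)] by (simp add: strain_def)
qed

lemma pair_weight_measurable: "pair_weight \<in> borel_measurable (lborel \<Otimes>\<^sub>M lborel)"
proof -
  have "pair_weight \<in> borel_measurable (borel \<Otimes>\<^sub>M borel)" unfolding pair_weight_def by measurable
  then show ?thesis by (simp add: measurable_def space_pair_measure sets_pair_measure_cong[OF sets_lborel sets_lborel])
qed

lemma pair_weight_bounds: "0 \<le> pair_weight p" "pair_weight p \<le> M"
proof -
  have J: "0 \<le> J (norm (snd p - fst p) / \<epsilon>)" "J (norm (snd p - fst p) / \<epsilon>) \<le> M"
    using J_bounds \<epsilon>_pos by simp_all
  then show "0 \<le> pair_weight p" unfolding pair_weight_def using \<omega>_bounds by simp
  have "\<omega> (fst p) * \<omega> (snd p) \<le> 1 * 1" using \<omega>_bounds by (intro mult_mono) auto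
  then have "pair_weight p \<le> 1 * M" unfolding pair_weight_def using J \<omega>_bounds by (intro mult_mono) auto
  then show "pair_weight p \<le> M" by simp
qed

text \<open>A bounded set of pairs off which bonds carry no energy, even when \<open>D\<close> is unbounded.\<close>

definition near_pairs :: "((real^'d) \<times> (real^'d)) set" where
  "near_pairs = ball 0 (R + \<epsilon>) \<times> ball 0 (R + \<epsilon>)"

lemma near_pairs_finite: "near_pairs \<in> sets (lborel \<Otimes>\<^sub>M lborel)" "emeasure (lborel \<Otimes>\<^sub>M lborel) near_pairs < \<infinity>"
proof -
  show "near_pairs \<in> sets (lborel \<Otimes>\<^sub>M lborel)" unfolding near_pairs_def by (intro pair_measureI) auto
  have "emeasure (lborel \<Otimes>\<^sub>M lborel) near_pairs = emeasure lborel (ball (0::real^'d) (R + \<epsilon>)) * emeasure lborel (ball (0::real^'d) (R + \<epsilon>))"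
    unfolding near_pairs_def by (intro lborel.emeasure_pair_measure_Times) auto
  then show "emeasure (lborel \<Otimes>\<^sub>M lborel) near_pairs < \<infinity>"
    using emeasure_lborel_ball_finite[of "0::real^'d" "R + \<epsilon>"] by (auto simp: ennreal_mult_less_top top.not_eq_extremum)
qed

lemma pair_strain_measurable:
  assumes "w \<in> V"
  shows "pair_strain w \<in> borel_measurable (lborel \<Otimes>\<^sub>M lborel)"
proof -
  note [measurable] = strain_measurable[OF assms]
  have "pair_strain w \<in> borel_measurable (borel \<Otimes>\<^sub>M borel)" unfolding pair_strain_def by measurable
  then show ?thesis by (simp add: measurable_def space_pair_measure sets_pair_measure_cong[OF sets_lborel sets_lborel])
qed

lemma pair_strain_bound:
  assumes "w \<in> V" "p \<in> near_pairs"
  shows "\<bar>pair_strain w p\<bar> \<le> sqrt (2 * (R + \<epsilon>)) * C * L2_norm D w"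
proof -
  have "norm (snd p - fst p) \<le> 2 * (R + \<epsilon>)"
    using assms(2) norm_triangle_ineq4[of "snd p" "fst p"] by (auto simp: near_pairs_def)
  then have "sqrt (norm (snd p - fst p)) * \<bar>strain (snd p) (fst p) w\<bar> \<le> sqrt (2 * (R + \<epsilon>)) * (C * L2_norm D w)"
    using R_pos \<epsilon>_pos by (intro mult_mono strain_bound assms(1)) auto
  then show ?thesis by (simp add: pair_strain_def abs_mult mult.assoc)
qed

lemma pair_strain_outside:
  assumes "w \<in> V" "p \<notin> near_pairs"
  shows "pair_weight p = 0 \<or> pair_strain w p = 0"
proof (cases "norm (snd p - fst p) < \<epsilon>")
  case True
  then show ?thesis
    using strain_eq_zero[OF assms(1), of "fst p" "snd p"] assms(2)
    by (cases p) (auto simp: near_pairs_def pair_strain_def)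
qed (simp add: pair_weight_def J_zero)

lemma pair_integrals_integrable:
  assumes "lipschitz_potential K f" "u \<in> V" "v \<in> V"
  shows "integrable (lborel \<Otimes>\<^sub>M lborel) (\<lambda>p. pair_weight p * f (pair_strain u p))"
    "integrable (lborel \<Otimes>\<^sub>M lborel) (\<lambda>p. pair_weight p * deriv f (pair_strain u p) * pair_strain v p)"
  by (rule integrable_weighted_potential[OF assms(1) M_nonneg pair_weight_measurable pair_weight_bounds near_pairs_finite
        pair_strain_measurable[OF assms(2)] pair_strain_bound[OF assms(2)] pair_strain_outside[OF assms(2)]
        pair_strain_measurable[OF assms(3)] pair_strain_bound[OF assms(3)] pair_strain_outside[OF assms(3)]]; assumption)+

lemma form_T_eq:
  assumes "lipschitz_potential K f" "u \<in> V" "v \<in> V"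
  shows "form_T \<epsilon> D J \<omega> f u v = 1 / (\<epsilon> ^ (CARD('d) + 1) * unit_ball_vol (real CARD('d))) *
    (\<integral>p. pair_weight p * deriv f (pair_strain u p) * pair_strain v p \<partial>(lborel \<Otimes>\<^sub>M lborel))"
proof -
  have "(LINT x|lebesgue_on D. LINT y|lebesgue_on D.
        pair_weight (x, y) * deriv f (pair_strain u (x, y)) * pair_strain v (x, y)) =
      (\<integral>p. pair_weight p * deriv f (pair_strain u p) * pair_strain v p \<partial>(lborel \<Otimes>\<^sub>M lborel))"
    using pair_integrals_integrable(2)[OF assms] open_D
    by (intro iterated_lebesgue_on_integral_eq) (auto simp: pair_weight_def \<omega>_outside)
  then show ?thesis by (simp add: form_T_def pair_weight_def pair_strain_def mult_ac)
qed

text \<open>The factor \<open>\<bar>y - x\<bar>\<close> cancels against the denominator except on the diagonal; there both sides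
  vanish because division by zero yields zero and \<open>f 0 = 0\<close>.\<close>

lemma pairwise_energy_eq:
  assumes f: "lipschitz_potential K f" and u: "u \<in> V"
  shows "(LINT x|lebesgue_on D. LINT y|lebesgue_on (ball x \<epsilon>).
        norm (y - x) * \<omega> x * \<omega> y * (J (norm (y - x) / \<epsilon>) / (\<epsilon> * norm (y - x))) *
        f (sqrt (norm (y - x)) * strain y x u)) =
      1 / \<epsilon> * (\<integral>p. pair_weight p * f (pair_strain u p) \<partial>(lborel \<Otimes>\<^sub>M lborel))"
proof -
  have "norm (y - x) * \<omega> x * \<omega> y * (J (norm (y - x) / \<epsilon>) / (\<epsilon> * norm (y - x))) *
      f (sqrt (norm (y - x)) * strain y x u) = 1 / \<epsilon> * (pair_weight (x, y) * f (pair_strain u (x, y)))" for x y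
    using f by (cases "y = x") (auto simp: pair_weight_def pair_strain_def lipschitz_potential_def)
  moreover have "(LINT x|lebesgue_on D. LINT y|lebesgue_on (ball x \<epsilon>). 1 / \<epsilon> * (pair_weight (x, y) * f (pair_strain u (x, y)))) =
      (\<integral>p. 1 / \<epsilon> * (pair_weight p * f (pair_strain u p)) \<partial>(lborel \<Otimes>\<^sub>M lborel))"
    using pair_integrals_integrable(1)[OF f u u] open_D
    by (intro iterated_lebesgue_on_integral_eq)
      (auto simp: pair_weight_def \<omega>_outside J_zero dist_norm norm_minus_commute not_less)
  ultimately show ?thesis by simp
qed

lemma dilation_integrand_integrable:
  assumes "w \<in> V"
  shows "integrable lborel (\<lambda>y. \<omega> y * J (norm (y - x) / \<epsilon>) * strain y x w * norm (y - x))"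
    and "\<bar>LINT y|lborel. \<omega> y * J (norm (y - x) / \<epsilon>) * strain y x w * norm (y - x)\<bar>
      \<le> M * (C * L2_norm D w) * \<epsilon> * measure lborel (ball x \<epsilon>)"
proof -
  have "(\<lambda>p. \<omega> (snd p) * J (norm (snd p - fst p) / \<epsilon>) * strain (snd p) (fst p) w * norm (snd p - fst p))
      \<in> borel_measurable (borel \<Otimes>\<^sub>M borel)"
    using strain_measurable[OF assms] by measurable
  from measurable_Pair2[OF this, of x]
  have m: "(\<lambda>y. \<omega> y * J (norm (y - x) / \<epsilon>) * strain y x w * norm (y - x)) \<in> borel_measurable lborel"
    by simp
  have fin: "emeasure lborel (ball x \<epsilon>) < \<infinity>"
    using emeasure_lborel_ball_finite[of x \<epsilon>] by (auto simp: top.not_eq_extremum)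
  have b: "\<bar>\<omega> y * J (norm (y - x) / \<epsilon>) * strain y x w * norm (y - x)\<bar> \<le> M * (C * L2_norm D w) * \<epsilon>"
    if "y \<in> ball x \<epsilon>" for y
  proof -
    have J: "0 \<le> J (norm (y - x) / \<epsilon>)" "J (norm (y - x) / \<epsilon>) \<le> M"
      using J_bounds \<epsilon>_pos by simp_all
    have "\<bar>\<omega> y\<bar> * \<bar>J (norm (y - x) / \<epsilon>)\<bar> \<le> 1 * M"
      using \<omega>_bounds J by (intro mult_mono) auto
    then show ?thesis unfolding abs_mult
      using that strain_bound[OF assms, of y x] M_nonneg \<epsilon>_pos C_nonneg L2_norm_nonneg[of D w]
      by (intro mult_mono) (auto simp: dist_norm norm_minus_commute)
  qed
  have z: "\<omega> y * J (norm (y - x) / \<epsilon>) * strain y x w * norm (y - x) = 0" if "y \<notin> ball x \<epsilon>" for y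
    using that by (simp add: J_zero dist_norm norm_minus_commute not_less)
  show "integrable lborel (\<lambda>y. \<omega> y * J (norm (y - x) / \<epsilon>) * strain y x w * norm (y - x))"
    by (rule integrable_bounded_finite_support(1)[OF m _ fin b z]) auto
  show "\<bar>LINT y|lborel. \<omega> y * J (norm (y - x) / \<epsilon>) * strain y x w * norm (y - x)\<bar>
      \<le> M * (C * L2_norm D w) * \<epsilon> * measure lborel (ball x \<epsilon>)"
    by (rule integrable_bounded_finite_support(2)[OF m _ fin b z]) auto
qed

lemma dilation_eq:
  assumes "w \<in> V"
  shows "dilation \<epsilon> J \<omega> x w = 1 / (\<epsilon> ^ CARD('d) * unit_ball_vol (real CARD('d))) *
    (LINT y|lborel. \<omega> y * J (norm (y - x) / \<epsilon>) * strain y x w * norm (y - x))"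
  unfolding dilation_def using dilation_integrand_integrable(1)[OF assms, of x]
  by (subst lebesgue_on_integral_eq_lborel) (auto simp: J_zero dist_norm norm_minus_commute not_less dest: borel_measurable_integrable)

lemma dilation_measurable:
  assumes "w \<in> V"
  shows "(\<lambda>x. dilation \<epsilon> J \<omega> x w) \<in> borel_measurable borel"
proof -
  have "(\<lambda>p. \<omega> (snd p) * J (norm (snd p - fst p) / \<epsilon>) * strain (snd p) (fst p) w * norm (snd p - fst p))
      \<in> borel_measurable (borel \<Otimes>\<^sub>M borel)"
    using strain_measurable[OF assms] by measurable
  then have "(\<lambda>p. \<omega> (snd p) * J (norm (snd p - fst p) / \<epsilon>) * strain (snd p) (fst p) w * norm (snd p - fst p))
      \<in> borel_measurable (borel \<Otimes>\<^sub>M lborel)"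
    by (simp add: measurable_def space_pair_measure sets_pair_measure_cong[OF refl sets_lborel])
  then have "(\<lambda>x. LINT y|lborel. \<omega> y * J (norm (y - x) / \<epsilon>) * strain y x w * norm (y - x)) \<in> borel_measurable borel"
    by (intro lborel.borel_measurable_lebesgue_integral) (simp add: case_prod_beta')
  then show ?thesis by (simp add: dilation_eq[OF assms])
qed

text \<open>The normalising constant of the dilation is exactly the volume of the ball of integration.\<close>

lemma dilation_bound:
  assumes "w \<in> V"
  shows "\<bar>dilation \<epsilon> J \<omega> x w\<bar> \<le> M * C * \<epsilon> * L2_norm D w"
proof -
  have v: "0 < \<epsilon> ^ CARD('d) * unit_ball_vol (real CARD('d))" using \<epsilon>_pos by simp
  have "measure lborel (ball x \<epsilon>) = \<epsilon> ^ CARD('d) * unit_ball_vol (real CARD('d))"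
    using content_ball[of \<epsilon> x] \<epsilon>_pos by simp
  with dilation_integrand_integrable(2)[OF assms, of x] show ?thesis
    unfolding dilation_eq[OF assms] abs_mult using v by (simp add: field_simps)
qed

lemma dilation_outside:
  assumes "w \<in> V" "R + \<epsilon> \<le> norm x"
  shows "dilation \<epsilon> J \<omega> x w = 0"
proof -
  have "J (norm (y - x) / \<epsilon>) * strain y x w = 0" for y
    using J_zero[of "norm (y - x)"] strain_eq_zero[OF assms(1), of x y] assms(2) by force
  then have "(\<lambda>y. \<omega> y * J (norm (y - x) / \<epsilon>) * strain y x w * norm (y - x)) = (\<lambda>y. 0)" by force
  then show ?thesis unfolding dilation_eq[OF assms(1)] by simp
qed

lemma dilation_difference_quotient:
  assumes w: "w1 \<in> V" "w2 \<in> V" "w3 \<in> V"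
  shows "dilation \<epsilon> J \<omega> x (\<lambda>z. (w1 z - w2 z) /\<^sub>R a - w3 z) =
    (dilation \<epsilon> J \<omega> x w1 - dilation \<epsilon> J \<omega> x w2) / a - dilation \<epsilon> J \<omega> x w3"
proof -
  define h where "h w y = \<omega> y * J (norm (y - x) / \<epsilon>) * strain y x w * norm (y - x)" for w y
  have h: "w \<in> V \<Longrightarrow> integrable lborel (h w)" for w
    unfolding h_def by (rule dilation_integrand_integrable(1))
  have "h (\<lambda>z. (w1 z - w2 z) /\<^sub>R a - w3 z) = (\<lambda>y. (h w1 y - h w2 y) / a - h w3 y)"
    unfolding h_def strain_difference_quotient by (simp add: fun_eq_iff divide_inverse algebra_simps)
  then have "integral\<^sup>L lborel (h (\<lambda>z. (w1 z - w2 z) /\<^sub>R a - w3 z)) =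
      (integral\<^sup>L lborel (h w1) - integral\<^sup>L lborel (h w2)) / a - integral\<^sup>L lborel (h w3)"
    using h w by simp
  then show ?thesis
    unfolding dilation_eq[OF w(1)] dilation_eq[OF w(2)] dilation_eq[OF w(3)]
      dilation_eq[OF difference_quotient_mem[OF w]] h_def[symmetric]
    by (simp only: diff_divide_distrib right_diff_distrib times_divide_eq_right)
qed

text \<open>The pairwise energy observes \<open>u\<close> through the scaled bond strain, the dilatational energy
  through the dilation. The two integrals so obtained are \<open>form_T\<close> and \<open>form_D\<close>: the domains of
  integration agree because \<open>\<omega>\<close> vanishes off \<open>D\<close> and \<open>J\<close> beyond the horizon.\<close>

lemma potential_energy_has_derivative:
  assumes f: "lipschitz_potential K f" and g: "lipschitz_potential K' g" and t: "t \<in> I"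
    and uv: "\<And>s. s \<in> I \<Longrightarrow> u s \<in> V" "\<And>s. s \<in> I \<Longrightarrow> v s \<in> V" "has_L2_time_derivative D I u v"
  shows "((\<lambda>s. potential_energy \<epsilon> D J \<omega> f g (u s)) has_real_derivative nonlocal_form \<epsilon> D J \<omega> f g (u t) (v t))
    (at t within I)"
proof -
  define c where "c = 1 / (\<epsilon> ^ (CARD('d) + 1) * unit_ball_vol (real CARD('d)))"
  note [measurable] = lipschitz_potential_measurable[OF g]
  have T: "((\<lambda>s. \<integral>p. pair_weight p * f (pair_strain (u s) p) \<partial>(lborel \<Otimes>\<^sub>M lborel)) has_real_derivative
      (\<integral>p. pair_weight p * deriv f (pair_strain (u t) p) * pair_strain (v t) p \<partial>(lborel \<Otimes>\<^sub>M lborel))) (at t within I)"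
    by (rule observed_potential_has_derivative[OF f M_nonneg pair_weight_measurable pair_weight_bounds near_pairs_finite t uv
          pair_strain_measurable pair_strain_bound pair_strain_outside])
      (auto simp: pair_strain_def strain_difference_quotient right_diff_distrib)
  have D: "((\<lambda>s. LINT x|lborel. \<omega> x * g (dilation \<epsilon> J \<omega> x (u s))) has_real_derivative
      (LINT x|lborel. \<omega> x * deriv g (dilation \<epsilon> J \<omega> x (u t)) * dilation \<epsilon> J \<omega> x (v t))) (at t within I)"
  proof (rule observed_potential_has_derivative[OF g, where l = "\<lambda>w x. dilation \<epsilon> J \<omega> x w" and M = 1 and A = "ball 0 (R + \<epsilon>)" and c = "M * C * \<epsilon>"])
    show "emeasure lborel (ball (0::real^'d) (R + \<epsilon>)) < \<infinity>"
      using emeasure_lborel_ball_finite[of 0 "R + \<epsilon>"] by (auto simp: top.not_eq_extremum)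
  qed (use \<omega>_bounds t uv dilation_measurable dilation_bound dilation_outside dilation_difference_quotient in auto)
  have pe: "c * (\<integral>p. pair_weight p * f (pair_strain (u s) p) \<partial>(lborel \<Otimes>\<^sub>M lborel)) +
      1 / \<epsilon>\<^sup>2 * (LINT x|lborel. \<omega> x * g (dilation \<epsilon> J \<omega> x (u s))) = potential_energy \<epsilon> D J \<omega> f g (u s)"
    if s: "s \<in> I" for s
  proof -
    have [measurable]: "(\<lambda>x. dilation \<epsilon> J \<omega> x (u s)) \<in> borel_measurable borel"
      by (rule dilation_measurable[OF uv(1)[OF s]])
    have "(LINT x|lebesgue_on D. \<omega> x * (g (dilation \<epsilon> J \<omega> x (u s)) / \<epsilon>\<^sup>2)) =
        (LINT x|lborel. \<omega> x * (g (dilation \<epsilon> J \<omega> x (u s)) / \<epsilon>\<^sup>2))"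
      using open_D by (intro lebesgue_on_integral_eq_lborel) (auto simp: \<omega>_outside)
    also have "\<dots> = 1 / \<epsilon>\<^sup>2 * (LINT x|lborel. \<omega> x * g (dilation \<epsilon> J \<omega> x (u s)))"
      by simp
    finally show ?thesis
      unfolding potential_energy_def pairwise_energy_eq[OF f uv(1)[OF s]] c_def by (auto simp: mult_ac)
  qed
  have nf: "nonlocal_form \<epsilon> D J \<omega> f g (u t) (v t) =
      c * (\<integral>p. pair_weight p * deriv f (pair_strain (u t) p) * pair_strain (v t) p \<partial>(lborel \<Otimes>\<^sub>M lborel)) +
      1 / \<epsilon>\<^sup>2 * (LINT x|lborel. \<omega> x * deriv g (dilation \<epsilon> J \<omega> x (u t)) * dilation \<epsilon> J \<omega> x (v t))"
  proof -
    note [measurable] = dilation_measurable[OF uv(1)[OF t]] dilation_measurable[OF uv(2)[OF t]]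
    have "(LINT x|lebesgue_on D. \<omega> x * deriv g (dilation \<epsilon> J \<omega> x (u t)) * dilation \<epsilon> J \<omega> x (v t)) =
        (LINT x|lborel. \<omega> x * deriv g (dilation \<epsilon> J \<omega> x (u t)) * dilation \<epsilon> J \<omega> x (v t))"
      using open_D by (intro lebesgue_on_integral_eq_lborel) (auto simp: \<omega>_outside)
    then show ?thesis
      unfolding nonlocal_form_def form_D_def form_T_eq[OF f uv(1)[OF t] uv(2)[OF t]] c_def by simp
  qed
  have "((\<lambda>s. c * (\<integral>p. pair_weight p * f (pair_strain (u s) p) \<partial>(lborel \<Otimes>\<^sub>M lborel)) +
      1 / \<epsilon>\<^sup>2 * (LINT x|lborel. \<omega> x * g (dilation \<epsilon> J \<omega> x (u s)))) has_real_derivative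
      nonlocal_form \<epsilon> D J \<omega> f g (u t) (v t)) (at t within I)"
    unfolding nf by (intro DERIV_add DERIV_cmult T D)
  then show ?thesis
    using t pe by (auto intro: has_field_derivative_transform_within[where d = 1])
qed

lemma potential_energy_nonneg:
  assumes "\<And>r. 0 \<le> f r" "\<And>r. 0 \<le> g r"
  shows "0 \<le> potential_energy \<epsilon> D J \<omega> f g w"
  unfolding potential_energy_def using assms \<omega>_bounds \<epsilon>_pos J_bounds(1)
  by (intro add_nonneg_nonneg mult_nonneg_nonneg Bochner_Integration.integral_nonneg divide_nonneg_nonneg) auto

text \<open>The velocity is an admissible test function. With it the scheme turns the sum of the two
  energy derivatives into the power \<open>(b, v)\<close> of the body force.\<close>

lemma semidiscrete_energy_bound:
  assumes f: "lipschitz_potential K f" and g: "lipschitz_potential K' g"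
    and b: "L2_continuous_on D {0..T} b"
    and sol: "semidiscrete_solution \<epsilon> D J \<omega> f g T b V u v a"
    and t: "t \<in> {0..T}"
  shows "total_energy \<epsilon> D J \<omega> f g (u t) (v t) \<le>
    (sqrt (total_energy \<epsilon> D J \<omega> f g (u 0) (v 0)) + integral {0..t} (\<lambda>\<tau>. L2_norm D (b \<tau>)))\<^sup>2"
proof -
  have V: "\<And>s. s \<in> {0..T} \<Longrightarrow> u s \<in> V" "\<And>s. s \<in> {0..T} \<Longrightarrow> v s \<in> V" "\<And>s. s \<in> {0..T} \<Longrightarrow> a s \<in> V"
    and der: "has_L2_time_derivative D {0..T} u v" "has_L2_time_derivative D {0..T} v a"
    and eq: "\<And>s w. s \<in> {0..T} \<Longrightarrow> w \<in> V \<Longrightarrow>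
      L2_inner D (a s) w + nonlocal_form \<epsilon> D J \<omega> f g (u s) w = L2_inner D (b s) w"
    using sol by (auto simp: semidiscrete_solution_def)
  define E where "E s = total_energy \<epsilon> D J \<omega> f g (u s) (v s)" for s
  have PD: "0 \<le> potential_energy \<epsilon> D J \<omega> f g (u s)" for s
    using f g by (intro potential_energy_nonneg) (auto simp: lipschitz_potential_def)
  have "E t \<le> (sqrt (E 0) + integral {0..t} (\<lambda>\<tau>. L2_norm D (b \<tau>)))\<^sup>2"
  proof (rule sqrt_energy_bound[where E' = "\<lambda>s. L2_inner D (b s) (v s)"])
    fix s assume s: "s \<in> {0..T}"
    show "(E has_real_derivative L2_inner D (b s) (v s)) (at s within {0..T})"
      unfolding E_def total_energy_def eq[OF s V(2)[OF s], symmetric]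
      by (intro DERIV_add kinetic_energy_has_derivative potential_energy_has_derivative[OF f g] s V der)
    show "0 \<le> E s" unfolding E_def total_energy_def using PD by simp
    show "0 \<le> L2_norm D (b s)" by (rule L2_norm_nonneg)
    have "(L2_norm D (v s))\<^sup>2 \<le> 2 * E s"
      unfolding E_def total_energy_def using PD[of s] by simp
    \<comment> \<open>Replacing 2 by 4 turns the factor \<open>sqrt 2\<close> of \<open>sqrt (E s)\<close> into the 2 that the bound on \<open>E'\<close> admits.\<close>
    also have "\<dots> \<le> 2\<^sup>2 * E s"
      unfolding E_def total_energy_def using PD[of s] by simp
    finally have "L2_norm D (v s) \<le> sqrt (2\<^sup>2 * E s)" by (rule real_le_rsqrt)
    then have v: "L2_norm D (v s) \<le> 2 * sqrt (E s)" by (simp add: real_sqrt_mult)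
    have "L2_inner D (b s) (v s) \<le> L2_norm D (b s) * L2_norm D (v s)"
      using L2_Cauchy_Schwarz[of "b s" D "v s"] b s V_subset_L2[OF V(2)[OF s]]
      by (auto simp: L2_continuous_on_def)
    also have "\<dots> \<le> L2_norm D (b s) * (2 * sqrt (E s))"
      by (intro mult_left_mono v L2_norm_nonneg)
    finally show "L2_inner D (b s) (v s) \<le> 2 * L2_norm D (b s) * sqrt (E s)" by (simp add: mult_ac)
  qed (use L2_continuous_on_norm[OF b] t in auto)
  then show ?thesis by (simp add: E_def)
qed

end

theorem theorem3p1:
  fixes D :: "(real^'d) set"
    and \<epsilon> M \<delta> \<sigma> h T rm rp :: real
    and J f g :: "real \<Rightarrow> real"
    and \<omega> :: "real^'d \<Rightarrow> real"
    and \<T> :: "(real^'d) set set"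
    and b u\<^sub>h v\<^sub>h a\<^sub>h :: "real \<Rightarrow> real^'d \<Rightarrow> real^'d"
  assumes "CARD('d) \<in> {2, 3}"
    and "open D" and "C1_boundary D"
    and "0 < \<epsilon>" and "0 < T"
    and "influence_function M J"
    and "0 < \<delta>" and "boundary_function D \<delta> \<omega>"
    and "convex_concave_potential f rm rp"
    and "(\<exists>\<beta>>0. \<forall>r. g r = \<beta> * r\<^sup>2 / 2) \<or> (\<exists>sm sp. convex_concave_potential g sm sp)"
    and "shape_regular_mesh D \<sigma> h \<T>"
    and "L2_continuous_on D {0..T} b"
    and "semidiscrete_solution \<epsilon> D J \<omega> f g T b (P1_space D \<T>) u\<^sub>h v\<^sub>h a\<^sub>h"
  shows "\<forall>t\<in>{0..T}.
    total_energy \<epsilon> D J \<omega> f g (u\<^sub>h t) (v\<^sub>h t) \<le>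
      (sqrt (total_energy \<epsilon> D J \<omega> f g (u\<^sub>h 0) (v\<^sub>h 0)) + integral {0..t} (\<lambda>\<tau>. L2_norm D (b \<tau>)))\<^sup>2"
proof
  fix t assume t: "t \<in> {0..T}"
  obtain R C where "uniformly_lipschitz_space D (P1_space D \<T>) R C"
    using P1_space_uniformly_lipschitz assms(2,11) by blast
  then interpret peridynamic_material D "P1_space D \<T>" R C \<epsilon> M J \<omega>
    using assms(4,6,8) boundary_function_measurable[OF assms(2,8)]
    by (intro peridynamic_material.intro peridynamic_material_axioms.intro)
      (auto simp: boundary_function_def)
  obtain K where K: "lipschitz_potential K f"
    using convex_concave_lipschitz_potential[OF assms(9)] by blast
  obtain K' where K': "lipschitz_potential K' g"
    using assms(10) quadratic_lipschitz_potential(1) convex_concave_lipschitz_potential by (meson less_imp_le)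
  show "total_energy \<epsilon> D J \<omega> f g (u\<^sub>h t) (v\<^sub>h t) \<le>
      (sqrt (total_energy \<epsilon> D J \<omega> f g (u\<^sub>h 0) (v\<^sub>h 0)) + integral {0..t} (\<lambda>\<tau>. L2_norm D (b \<tau>)))\<^sup>2"
    by (rule semidiscrete_energy_bound[OF K K' assms(12,13) t])
qed

end
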